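(* There is a family of random tape, adversarially robust streaming algorithms such that, for all integers $1\le \ell< n$ and all $\delta\in(0,1)$, the algorithm for $\textsc{mif}(n,\ell)$ has error at most $\delta$ and uses \[ O\left(\left\lceil \frac{(4 \ell)^{\frac{2}{d - 1}}}{(n/4)^{\frac{2}{d(d-1)}}} \right\rceil (\log \ell)^2 + \min\left(\ell,\, \log \tfrac{1}{\delta}\right) \log \ell \right) \] bits of space, where $d = \max\left(2, \min\left(\lceil\log \ell\rceil, \left\lfloor 2 \frac{\log(n/4)}{\log(16\ell)}\right\rfloor\right)\right)$ (logarithms base 2). In particular, when $\delta = 1/\mathrm{poly}(n)$, the space used is $O\left(\ell^{\log_n \ell} (\log \ell)^2 + \log \ell\,\log n\right)$.
   Context: The Missing Item Finding problem $\textsc{mif}(n,\ell)$: the input is a stream $e_1,\dots,e_\ell$ with each $e_i \in [n]=\{1,\dots,n\}$; after receiving $e_i$ the algorithm must output some $v \in [n]\setminus\{e_1,\dots,e_i\}$, and the whole sequence of outputs must be correct. A streaming algorithm with state set $\Sigma$ uses $\log_2|\Sigma|$ bits of space; each state has an associated output. A random tape algorithm draws its initial state from a distribution over $\Sigma$, and on each input moves to a state determined by the current state, the input, and fresh randomness independent of all previous choices; outputs are a deterministic function of the state. It is adversarially robust with error $\delta$ if against every adaptive adversary (a function mapping the outputs seen so far to the next input) the probability of ever producing an incorrect output is at most $\delta$.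
   Formalization: For ℓ = 1 both space expressions equal 0, but zero bits means one constant output, which an adversary defeats with probability 1; the bounds are therefore read as O(max(1, ·)), which changes nothing for ℓ ≥ 2. *)

theory Defs
  imports "HOL-Probability.Probability"
begin

text \<open>
  A random tape streaming algorithm over inputs and outputs of type \<^typ>\<open>nat\<close>. The fresh
  randomness used in each step is modelled by the transition kernel: the next state is drawn
  from a distribution determined by the current state and the input alone.
\<close>

record 's rt_alg =
  states :: "'s set"
  init_dist :: "'s pmf"
  trans_dist :: "'s \<Rightarrow> nat \<Rightarrow> 's pmf"
  state_output :: "'s \<Rightarrow> nat"

definition rt_algorithm :: "nat \<Rightarrow> 's rt_alg \<Rightarrow> bool" where
  "rt_algorithm n A \<longleftrightarrow>
     finite (states A) \<and>
     set_pmf (init_dist A) \<subseteq> states A \<and>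
     (\<forall>s\<in>states A. \<forall>e\<in>{1..n}. set_pmf (trans_dist A s e) \<subseteq> states A)"

definition space_bits :: "'s rt_alg \<Rightarrow> real" where
  "space_bits A = log 2 (real (card (states A)))"

text \<open>
  The run of \<^term>\<open>A\<close> against an adversary, which maps the list of outputs seen so far to the
  next input. The result is the joint distribution of the current state, the list of inputs
  sent and the list of outputs given (both oldest first). The output of the initial state is not
  part of the transcript, as an output is only given after an input has been received.
\<close>

primrec rt_run :: "'s rt_alg \<Rightarrow> (nat list \<Rightarrow> nat) \<Rightarrow> nat \<Rightarrow> ('s \<times> nat list \<times> nat list) pmf" where
  "rt_run A adv 0 = map_pmf (\<lambda>s. (s, [], [])) (init_dist A)"
| "rt_run A adv (Suc i) =
     bind_pmf (rt_run A adv i) (\<lambda>(s, es, vs).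
       map_pmf (\<lambda>s'. (s', es @ [adv vs], vs @ [state_output A s'])) (trans_dist A s (adv vs)))"

definition mif_correct :: "nat \<Rightarrow> nat list \<Rightarrow> nat list \<Rightarrow> bool" where
  "mif_correct n es vs \<longleftrightarrow>
     length vs = length es \<and>
     (\<forall>i<length vs. vs ! i \<in> {1..n} - set (take (Suc i) es))"

definition mif_error :: "nat \<Rightarrow> nat \<Rightarrow> 's rt_alg \<Rightarrow> (nat list \<Rightarrow> nat) \<Rightarrow> real" where
  "mif_error n l A adv =
     measure_pmf.prob (rt_run A adv l) {(s, es, vs). \<not> mif_correct n es vs}"

definition mif_robust :: "nat \<Rightarrow> nat \<Rightarrow> real \<Rightarrow> 's rt_alg \<Rightarrow> bool" where
  "mif_robust n l \<delta> A \<longleftrightarrow>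
     (\<forall>adv. (\<forall>vs. adv vs \<in> {1..n}) \<longrightarrow> mif_error n l A adv \<le> \<delta>)"

definition mif_d :: "nat \<Rightarrow> nat \<Rightarrow> int" where
  "mif_d n l =
     max 2 (min \<lceil>log 2 (real l)\<rceil> \<lfloor>2 * (log 2 (real n / 4) / log 2 (16 * real l))\<rfloor>)"

definition mif_bound :: "nat \<Rightarrow> nat \<Rightarrow> real \<Rightarrow> real" where
  "mif_bound n l \<delta> =
     (let d = real_of_int (mif_d n l) in
        real_of_int \<lceil>(4 * real l) powr (2 / (d - 1)) / (real n / 4) powr (2 / (d * (d - 1)))\<rceil>
          * (log 2 (real l))\<^sup>2
        + min (real l) (log 2 (1 / \<delta>)) * log 2 (real l))"

definition mif_bound_poly :: "nat \<Rightarrow> nat \<Rightarrow> real" where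
  "mif_bound_poly n l =
     real l powr (log (real n) (real l)) * (log 2 (real l))\<^sup>2 + log 2 (real l) * log 2 (real n)"

text \<open>
  Both bounds vanish for a stream of length 1, where zero bits (a single state) cannot suffice for
  error below one. A big-O bound is therefore read as a constant multiple of the maximum of 1 and
  the expression. By the two lemmas below, this changes nothing for streams of length at least 2.
\<close>

lemma max_1_mif_bound:
  assumes "2 \<le> l" "l < n" "0 < \<delta>" "\<delta> < 1"
  shows "max 1 (mif_bound n l \<delta>) = mif_bound n l \<delta>"
proof -
  define x where "x = (4 * real l) powr (2 / (real_of_int (mif_d n l) - 1)) /
    (real n / 4) powr (2 / (real_of_int (mif_d n l) * (real_of_int (mif_d n l) - 1)))"
  have L: "1 \<le> log 2 (real l)" using assms by simp
  have "0 < x" unfolding x_def using assms by (intro divide_pos_pos) auto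
  then have c: "1 \<le> real_of_int \<lceil>x\<rceil>" by simp
  have "1 \<le> (log 2 (real l))\<^sup>2" using L by (simp add: one_le_power)
  then have "1 * 1 \<le> real_of_int \<lceil>x\<rceil> * (log 2 (real l))\<^sup>2" using c by (intro mult_mono) auto
  moreover have "0 \<le> log 2 (1 / \<delta>)" using assms by simp
  then have "0 \<le> min (real l) (log 2 (1 / \<delta>)) * log 2 (real l)" using L by simp
  ultimately have "1 \<le> mif_bound n l \<delta>" by (simp add: mif_bound_def Let_def x_def)
  then show ?thesis by simp
qed

lemma max_1_mif_bound_poly:
  assumes "2 \<le> l" "l < n"
  shows "max 1 (mif_bound_poly n l) = mif_bound_poly n l"
proof -
  have L: "1 \<le> log 2 (real l)" and N: "1 \<le> log 2 (real n)" using assms by auto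
  then have "1 * 1 \<le> log 2 (real l) * log 2 (real n)" by (intro mult_mono) auto
  moreover have "0 \<le> real l powr (log (real n) (real l)) * (log 2 (real l))\<^sup>2" by simp
  ultimately have "1 \<le> mif_bound_poly n l" unfolding mif_bound_poly_def by linarith
  then show ?thesis by simp
qed

end

theory Submission
  imports Defs
begin

text \<open>
  The outputs are the leaves of a tree with \<open>D\<close> levels. A node of level \<open>i\<close> has
  \<open>w\<^sub>i = 6 b\<^sub>i \<dots> b\<^sub>D\<close> children, and along the current root-to-leaf path the algorithm stores, for
  every level, a secret random list of \<open>b\<^sub>i\<close> of them, the head being on the path. An input follows
  the path up to the first level where it disagrees; if it hits a listed child there, that child is
  dropped. If it hits the current leaf, the path moves to the next listed child at the deepest level
  whose list is not exhausted, and fresh lists are drawn below. The algorithm fails only when the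
  root list is used up.

  By deferred decisions, the part of a list behind its head may be drawn only when it is used; then
  the chance of an early hit is visible. Charging \<open>\<kappa> b\<^sub>i\<^sub>+\<^sub>1 \<dots> b\<^sub>D\<close> for every lost entry of level
  \<open>i\<close> gives an exponential potential whose expectation grows by a factor of at most \<open>exp \<kappa>\<close> per
  input, while failure costs \<open>exp (\<kappa> b\<^sub>1 \<dots> b\<^sub>D)\<close>. With \<open>b\<^sub>1 \<dots> b\<^sub>D \<ge> 2 l\<close> and
  \<open>\<kappa> = 1 / (b\<^sub>2 \<dots> b\<^sub>D)\<close> the failure probability is at most \<open>exp (- b\<^sub>1 / 2)\<close>, so only \<open>b\<^sub>1\<close> has to
  grow with \<open>log (1 / \<delta>)\<close>. The other \<open>b\<^sub>i\<close> are a constant multiple of the ceiling in the bound, which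
  is what makes \<open>w\<^sub>1 \<dots> w\<^sub>D\<close> fit below \<open>n\<close>. Whenever this choice would not beat \<open>l + 1\<close> bits, the
  set of inputs seen in \<open>{1..l+1}\<close> is stored instead.
\<close>

section \<open>Transferring runs between algorithms\<close>

text \<open>
  \<open>K\<close> draws a state of \<open>A\<close> from a state of \<open>B\<close>; commuting with the steps makes the transcripts
  equally distributed even though the adversary is adaptive.
\<close>

lemma rt_run_intertwine:
  assumes init: "init_dist A = bind_pmf (init_dist B) K"
    and step: "\<And>l e. l \<in> I \<Longrightarrow> bind_pmf (K l) (\<lambda>s. trans_dist A s e) = bind_pmf (trans_dist B l e) K"
    and I_init: "set_pmf (init_dist B) \<subseteq> I"
    and I_step: "\<And>l e. l \<in> I \<Longrightarrow> set_pmf (trans_dist B l e) \<subseteq> I"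
    and out: "\<And>l s. l \<in> I \<Longrightarrow> s \<in> set_pmf (K l) \<Longrightarrow> state_output A s = state_output B l"
  shows "rt_run A adv i = bind_pmf (rt_run B adv i) (\<lambda>(l, es, vs). map_pmf (\<lambda>s. (s, es, vs)) (K l))
         \<and> (\<forall>(l, es, vs) \<in> set_pmf (rt_run B adv i). l \<in> I)"
proof (induction i)
  case 0
  show ?case using I_init
    by (auto simp: init map_pmf_def bind_assoc_pmf bind_return_pmf)
next
  case (Suc i)
  have inI: "\<And>l es vs. (l, es, vs) \<in> set_pmf (rt_run B adv i) \<Longrightarrow> l \<in> I"
    using Suc by auto
  \<comment> \<open>The transcript is fixed here, so the input \<open>adv vs\<close> is a single
    element and \<open>step\<close> applies to it; \<open>out\<close> lets the output be read off
    the state of \<open>B\<close>.\<close>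
  have key: "bind_pmf (map_pmf (\<lambda>s. (s, es, vs)) (K l)) (\<lambda>(s, es, vs).
       map_pmf (\<lambda>s'. (s', es @ [adv vs], vs @ [state_output A s'])) (trans_dist A s (adv vs)))
     = bind_pmf (map_pmf (\<lambda>l'. (l', es @ [adv vs], vs @ [state_output B l'])) (trans_dist B l (adv vs)))
       (\<lambda>(l, es, vs). map_pmf (\<lambda>s. (s, es, vs)) (K l))" (is "?L = ?R") if l: "l \<in> I" for l es vs
  proof -
    have "?L = map_pmf (\<lambda>s'. (s', es @ [adv vs], vs @ [state_output A s']))
            (bind_pmf (K l) (\<lambda>s. trans_dist A s (adv vs)))"
      by (simp add: bind_map_pmf map_bind_pmf)
    also have "\<dots> = bind_pmf (trans_dist B l (adv vs))
        (\<lambda>l'. map_pmf (\<lambda>s'. (s', es @ [adv vs], vs @ [state_output A s'])) (K l'))"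
      by (simp add: step[OF l] map_bind_pmf)
    also have "\<dots> = bind_pmf (trans_dist B l (adv vs))
        (\<lambda>l'. map_pmf (\<lambda>s'. (s', es @ [adv vs], vs @ [state_output B l'])) (K l'))"
    proof (intro bind_pmf_cong refl map_pmf_cong)
      fix l' s' assume "l' \<in> set_pmf (trans_dist B l (adv vs))" "s' \<in> set_pmf (K l')"
      then show "(s', es @ [adv vs], vs @ [state_output A s']) = (s', es @ [adv vs], vs @ [state_output B l'])"
        using I_step[OF l] out by auto
    qed
    also have "\<dots> = ?R" by (simp add: bind_map_pmf)
    finally show ?thesis .
  qed
  have "rt_run A adv (Suc i) = bind_pmf (rt_run B adv i) (\<lambda>(l, es, vs).
     bind_pmf (map_pmf (\<lambda>s. (s, es, vs)) (K l)) (\<lambda>(s, es, vs).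
       map_pmf (\<lambda>s'. (s', es @ [adv vs], vs @ [state_output A s'])) (trans_dist A s (adv vs))))"
    unfolding rt_run.simps Suc[THEN conjunct1] bind_assoc_pmf
    by (intro bind_pmf_cong refl) auto
  also have "\<dots> = bind_pmf (rt_run B adv i) (\<lambda>(l, es, vs).
     bind_pmf (map_pmf (\<lambda>l'. (l', es @ [adv vs], vs @ [state_output B l'])) (trans_dist B l (adv vs)))
       (\<lambda>(l, es, vs). map_pmf (\<lambda>s. (s, es, vs)) (K l)))"
    by (intro bind_pmf_cong refl) (auto simp: key dest: inI)
  also have "\<dots> = bind_pmf (rt_run B adv (Suc i)) (\<lambda>(l, es, vs). map_pmf (\<lambda>s. (s, es, vs)) (K l))"
    unfolding rt_run.simps bind_assoc_pmf by (intro bind_pmf_cong refl) auto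
  finally show ?case using I_step inI by fastforce
qed

lemma mif_error_transcript:
  "mif_error n m A adv = measure_pmf.prob (map_pmf snd (rt_run A adv m)) {(es, vs). \<not> mif_correct n es vs}"
  unfolding mif_error_def measure_map_pmf by (rule arg_cong[where f="measure_pmf.prob _"]) auto

text \<open>Once the state is dropped from both runs, the draw from the probability kernel
  \<open>K\<close> leaves no trace in the transcript.\<close>

lemma mif_error_intertwine:
  assumes "init_dist A = bind_pmf (init_dist B) K"
    and "\<And>l e. l \<in> I \<Longrightarrow> bind_pmf (K l) (\<lambda>s. trans_dist A s e) = bind_pmf (trans_dist B l e) K"
    and "set_pmf (init_dist B) \<subseteq> I"
    and "\<And>l e. l \<in> I \<Longrightarrow> set_pmf (trans_dist B l e) \<subseteq> I"
    and "\<And>l s. l \<in> I \<Longrightarrow> s \<in> set_pmf (K l) \<Longrightarrow> state_output A s = state_output B l"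
  shows "mif_error n m A adv = mif_error n m B adv"
proof -
  have "map_pmf snd (rt_run A adv m) = map_pmf snd (rt_run B adv m)"
    using rt_run_intertwine[OF assms, of adv m]
    by (simp add: map_bind_pmf split_beta pmf.map_comp o_def map_pmf_const)
       (simp add: map_pmf_def)
  then show ?thesis by (simp add: mif_error_transcript)
qed

text \<open>One family over all parameters needs one state type, whereas the tree algorithm has
  lists as states; an injection into \<open>nat\<close> changes neither space nor error.\<close>

definition nat_alg :: "('s::countable) rt_alg \<Rightarrow> nat rt_alg" where
  "nat_alg A = \<lparr>states = to_nat ` states A, init_dist = map_pmf to_nat (init_dist A),
     trans_dist = (\<lambda>s e. map_pmf to_nat (trans_dist A (from_nat s) e)),
     state_output = (\<lambda>s. state_output A (from_nat s))\<rparr>"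

lemma rt_algorithm_nat_alg: "rt_algorithm n A \<Longrightarrow> rt_algorithm n (nat_alg A)"
  by (fastforce simp: rt_algorithm_def nat_alg_def)

lemma space_bits_nat_alg: "space_bits (nat_alg A) = space_bits A"
  by (simp add: space_bits_def nat_alg_def card_image)

lemma mif_error_nat_alg: "mif_error n m (nat_alg A) adv = mif_error n m A adv"
  by (rule mif_error_intertwine[where K="\<lambda>s. return_pmf (to_nat s)" and I=UNIV])
     (auto simp: nat_alg_def map_pmf_def bind_return_pmf)

lemma mif_robust_nat_alg: "mif_robust n m \<delta> A \<Longrightarrow> mif_robust n m \<delta> (nat_alg A)"
  by (simp add: mif_robust_def mif_error_nat_alg)

text \<open>A supermartingale argument: the one-step bound is uniform in the input, so it survives
  every input chosen from the outputs so far.\<close>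

lemma nn_integral_rt_run_le:
  assumes I_init: "set_pmf (init_dist B) \<subseteq> I"
    and I_step: "\<And>l e. l \<in> I \<Longrightarrow> set_pmf (trans_dist B l e) \<subseteq> I"
    and init: "\<And>l. l \<in> set_pmf (init_dist B) \<Longrightarrow> \<Phi> l \<le> 1"
    and step: "\<And>l e. l \<in> I \<Longrightarrow> (\<integral>\<^sup>+ l'. \<Phi> l' \<partial>measure_pmf (trans_dist B l e)) \<le> c * \<Phi> l"
  shows "(\<integral>\<^sup>+ x. \<Phi> (fst x) \<partial>measure_pmf (rt_run B adv i)) \<le> c ^ i
     \<and> (\<forall>x \<in> set_pmf (rt_run B adv i). fst x \<in> I)"
proof (induction i)
  case 0
  have "(\<integral>\<^sup>+ l. \<Phi> l \<partial>measure_pmf (init_dist B)) \<le> (\<integral>\<^sup>+ l. 1 \<partial>measure_pmf (init_dist B))"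
    by (intro nn_integral_mono_AE) (auto simp: AE_measure_pmf_iff init)
  then show ?case using I_init by auto
next
  case (Suc i)
  have "(\<integral>\<^sup>+ x. \<Phi> (fst x) \<partial>measure_pmf (rt_run B adv (Suc i)))
     = (\<integral>\<^sup>+ x. (\<integral>\<^sup>+ l'. \<Phi> l' \<partial>measure_pmf (trans_dist B (fst x) (adv (snd (snd x))))) \<partial>measure_pmf (rt_run B adv i))"
    by (simp add: case_prod_beta)
  also have "\<dots> \<le> (\<integral>\<^sup>+ x. c * \<Phi> (fst x) \<partial>measure_pmf (rt_run B adv i))"
    using Suc by (intro nn_integral_mono_AE) (auto simp: AE_measure_pmf_iff intro!: step)
  also have "\<dots> \<le> c * c ^ i"
    using Suc by (simp add: nn_integral_cmult mult_left_mono)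
  finally show ?case using I_step Suc by fastforce
qed

section \<open>The tree algorithm and its lazy version\<close>

fun distinct_list_pmf :: "'a set \<Rightarrow> nat \<Rightarrow> 'a list pmf" where
  "distinct_list_pmf U 0 = return_pmf []"
| "distinct_list_pmf U (Suc s) =
     bind_pmf (pmf_of_set U) (\<lambda>h. map_pmf ((#) h) (distinct_list_pmf (U - {h}) s))"

lemma set_distinct_list_pmf:
  assumes "finite U" "s \<le> card U" "xs \<in> set_pmf (distinct_list_pmf U s)"
  shows "set xs \<subseteq> U \<and> length xs = s"
  using assms
proof (induction s arbitrary: U xs)
  case (Suc s)
  then have "U \<noteq> {}" by auto
  with Suc.prems obtain h ys where h: "h \<in> U" "xs = h # ys"
    and ys: "ys \<in> set_pmf (distinct_list_pmf (U - {h}) s)" by auto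
  have "set ys \<subseteq> U - {h} \<and> length ys = s"
    using Suc.prems h by (intro Suc.IH[OF _ _ ys]) auto
  then show ?case using h by auto
qed auto

text \<open>This justifies deferred decisions: a fixed \<open>a\<close> lies in the random list with
  probability \<open>s / card U\<close>, and given either answer the other entries are drawn without
  replacement from \<open>U - {a}\<close>. The induction conditions on the first entry.\<close>

lemma map_removeAll_distinct_list_pmf:
  assumes "finite U" "a \<in> U" "s \<le> card U"
  shows "map_pmf (removeAll a) (distinct_list_pmf U s) =
    bind_pmf (bernoulli_pmf (real s / real (card U)))
      (\<lambda>c. distinct_list_pmf (U - {a}) (if c then s - 1 else s))"
  using assms
proof (induction s arbitrary: U)
  case 0
  have "pmf (bernoulli_pmf 0) = pmf (return_pmf False)"
    by (rule ext) (simp add: pmf_return indicator_def)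
  then have "bernoulli_pmf 0 = return_pmf False" by (simp add: pmf_eq_iff)
  then show ?case by (simp add: bind_return_pmf)
next
  case (Suc s)
  define u where "u = card U"
  have u: "u > 0" "card (U - {a}) = u - 1" using Suc.prems by (auto simp: u_def card_gt_0_iff)
  have ne: "U \<noteq> {}" using Suc.prems by auto
  let ?D = distinct_list_pmf
  show ?case
  proof (rule pmf_eqI)
    fix ys
    have ra: "map_pmf (removeAll a) (?D (U - {a}) s) = ?D (U - {a}) s"
    proof -
      have "map_pmf (removeAll a) (?D (U - {a}) s) = map_pmf id (?D (U - {a}) s)"
        using Suc.prems u by (intro map_pmf_cong refl) (auto dest!: set_distinct_list_pmf[rotated -1] intro!: removeAll_id)
      then show ?thesis by simp
    qed
    \<comment> \<open>A first entry \<open>h \<noteq> a\<close> survives, and the induction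
      hypothesis decides about the tail.\<close>
    have one: "pmf (map_pmf (removeAll a) (map_pmf ((#) h) (?D (U - {h}) s))) ys =
        real s / real (u - 1) * pmf (map_pmf ((#) h) (?D (U - {a} - {h}) (s - 1))) ys
        + (1 - real s / real (u - 1)) * pmf (map_pmf ((#) h) (?D (U - {a} - {h}) s)) ys"
      if h: "h \<in> U - {a}" for h
    proof -
      have s1: "s \<le> u - 1" and cu: "card (U - {h}) = u - 1" using Suc.prems h by (auto simp: u_def)
      have p: "0 \<le> real s / real (u - 1)" "real s / real (u - 1) \<le> 1"
        using s1 by (auto simp: divide_simps)
      have "map_pmf (removeAll a) (map_pmf ((#) h) (?D (U - {h}) s))
         = map_pmf ((#) h) (map_pmf (removeAll a) (?D (U - {h}) s))"
        using h by (auto simp: pmf.map_comp o_def intro!: map_pmf_cong)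
      also have "map_pmf (removeAll a) (?D (U - {h}) s) = bind_pmf (bernoulli_pmf (real s / real (u - 1)))
          (\<lambda>c. ?D (U - {h} - {a}) (if c then s - 1 else s))"
        using Suc.prems h s1 cu by (subst Suc.IH) auto
      also have "U - {h} - {a} = U - {a} - {h}" by auto
      finally show ?thesis using p
        by (simp add: map_bind_pmf pmf_bind integral_bernoulli_pmf)
    qed
    \<comment> \<open>Summing over the first entry turns tails of length \<open>t\<close> back into
      lists of length \<open>t + 1\<close>.\<close>
    have two: "(\<Sum>h\<in>U - {a}. pmf (map_pmf ((#) h) (?D (U - {a} - {h}) t)) ys) = real (u - 1) * pmf (?D (U - {a}) (Suc t)) ys" for t
    proof (cases "U - {a} = {}")
      case True
      then have "u - 1 = 0" using u(2) by (metis card.empty)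
      then show ?thesis unfolding True by simp
    next
      case False
      then have "u - 1 > 0" using Suc.prems u by (metis card_gt_0_iff finite_Diff)
      with False show ?thesis using Suc.prems u by (simp add: pmf_bind_pmf_of_set)
    qed
    \<comment> \<open>The factor \<open>real s\<close> covers \<open>s = 0\<close>, where
      \<open>s - 1\<close> is not a predecessor.\<close>
    have three: "real s * ((\<Sum>h\<in>U - {a}. pmf (map_pmf ((#) h) (?D (U - {a} - {h}) (s - 1))) ys)) =
         real s * (real (u - 1) * pmf (?D (U - {a}) s) ys)"
      using two[of "s - 1"] by (cases s) auto
    have "pmf (map_pmf (removeAll a) (?D U (Suc s))) ys =
      (\<Sum>h\<in>U. pmf (map_pmf (removeAll a) (map_pmf ((#) h) (?D (U - {h}) s))) ys) / u"
      using Suc.prems ne by (simp add: map_bind_pmf pmf_bind_pmf_of_set u_def)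
    also have "(\<Sum>h\<in>U. pmf (map_pmf (removeAll a) (map_pmf ((#) h) (?D (U - {h}) s))) ys) =
       pmf (?D (U - {a}) s) ys + (\<Sum>h\<in>U - {a}. pmf (map_pmf (removeAll a) (map_pmf ((#) h) (?D (U - {h}) s))) ys)"
      using Suc.prems ra by (subst sum.remove[of _ a]) (auto simp: pmf.map_comp o_def)
    also have "(\<Sum>h\<in>U - {a}. pmf (map_pmf (removeAll a) (map_pmf ((#) h) (?D (U - {h}) s))) ys) =
       real s / real (u - 1) * (\<Sum>h\<in>U - {a}. pmf (map_pmf ((#) h) (?D (U - {a} - {h}) (s - 1))) ys)
       + (1 - real s / real (u - 1)) * (\<Sum>h\<in>U - {a}. pmf (map_pmf ((#) h) (?D (U - {a} - {h}) s)) ys)"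
      by (simp add: one sum.distrib sum_distrib_left)
    also have "\<dots> = real s * pmf (?D (U - {a}) s) ys + (real (u - 1) - real s) * pmf (?D (U - {a}) (Suc s)) ys"
    proof (cases "u = 1")
      case True
      then have su: "s = 0" "U - {a} = {}" using Suc.prems u u_def by (auto simp: card_1_singleton_iff)
      show ?thesis unfolding su(2) using True su(1) by simp
    next
      case False
      then have nz: "real (u - 1) \<noteq> 0" using u by auto
      have "real s / real (u - 1) * (\<Sum>h\<in>U - {a}. pmf (map_pmf ((#) h) (?D (U - {a} - {h}) (s - 1))) ys) =
         real s * pmf (?D (U - {a}) s) ys"
        using three nz by (simp add: field_simps)
      moreover have "(1 - real s / real (u - 1)) * real (u - 1) = real (u - 1) - real s"
        using nz by (simp add: field_simps)
      ultimately show ?thesis unfolding two by (metis mult.assoc)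
    qed
    finally have L: "pmf (map_pmf (removeAll a) (?D U (Suc s))) ys =
      (real (Suc s) * pmf (?D (U - {a}) s) ys + (real u - real (Suc s)) * pmf (?D (U - {a}) (Suc s)) ys) / u"
      using u by (simp add: algebra_simps of_nat_diff)
    have p: "0 \<le> real (Suc s) / real u" "real (Suc s) / real u \<le> 1"
      using u Suc.prems by (auto simp: divide_simps u_def)
    have "pmf (bind_pmf (bernoulli_pmf (real (Suc s) / real u))
          (\<lambda>c. ?D (U - {a}) (if c then Suc s - 1 else Suc s))) ys
        = real (Suc s) / real u * pmf (?D (U - {a}) s) ys + (1 - real (Suc s) / real u) * pmf (?D (U - {a}) (Suc s)) ys"
      using p by (simp add: pmf_bind integral_bernoulli_pmf del: distinct_list_pmf.simps)
    also have "\<dots> = (real (Suc s) * pmf (?D (U - {a}) s) ys + (real u - real (Suc s)) * pmf (?D (U - {a}) (Suc s)) ys) / u"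
      using u by (simp add: field_simps del: distinct_list_pmf.simps)
    finally show "pmf (map_pmf (removeAll a) (?D U (Suc s))) ys =
      pmf (bind_pmf (bernoulli_pmf (real (Suc s) / real (card U)))
          (\<lambda>c. ?D (U - {a}) (if c then Suc s - 1 else Suc s))) ys"
      using L unfolding u_def by argo
  qed
qed

text \<open>
  The argument lists \<open>b\<^sub>i, \<dots>, b\<^sub>D\<close> for a subtree rooted at level \<open>i\<close>, and the value is \<open>w\<^sub>i\<close>.
\<close>

definition width :: "nat list \<Rightarrow> nat" where
  "width bs = 6 * prod_list bs"

fun tree_size :: "nat list \<Rightarrow> nat" where
  "tree_size [] = 1"
| "tree_size (b # bs) = width (b # bs) * tree_size bs"

fun tree_init :: "nat list \<Rightarrow> nat list list pmf" where
  "tree_init [] = return_pmf []"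
| "tree_init (b # bs) = bind_pmf (distinct_list_pmf {..<width (b # bs)} b)
     (\<lambda>xs. map_pmf ((#) xs) (tree_init bs))"

text \<open>\<^term>\<open>None\<close> reports that the subtree is used up; a leaf is used up by the first query.\<close>

fun tree_step :: "nat list \<Rightarrow> nat list list \<Rightarrow> nat \<Rightarrow> nat list list option pmf" where
  "tree_step (b # bs) (xs # r) v =
     (let a = v div tree_size bs in
      if a = hd xs then
        bind_pmf (tree_step bs r (v mod tree_size bs)) (\<lambda>ro. case ro of
            Some r' \<Rightarrow> return_pmf (Some (xs # r'))
          | None \<Rightarrow> if tl xs = [] then return_pmf None
              else map_pmf (\<lambda>r'. Some (tl xs # r')) (tree_init bs))
      else return_pmf (Some (removeAll a xs # r)))"
| "tree_step _ _ v = return_pmf None"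

text \<open>Leaves are numbered in mixed radix: the quotient by \<open>tree_size bs\<close> names
  the child, the remainder the leaf below it. \<open>tree_step\<close> decodes queries in the same
  way.\<close>

fun tree_output :: "nat list \<Rightarrow> nat list list \<Rightarrow> nat" where
  "tree_output (b # bs) (xs # r) = hd xs * tree_size bs + tree_output bs r"
| "tree_output _ _ = 0"

fun tree_states :: "nat list \<Rightarrow> nat list list set" where
  "tree_states [] = {[]}"
| "tree_states (b # bs) = (\<lambda>(xs, r). xs # r) `
     ({xs. set xs \<subseteq> {..<width (b # bs)} \<and> length xs \<le> b} \<times> tree_states bs)"

text \<open>
  A level \<open>(h, s, U)\<close> of the lazy process stands for the head \<open>h\<close> followed by \<open>s\<close> distinct, not yet
  drawn, children from the set \<open>U\<close> of those that have neither been queried nor been on the path.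
\<close>

type_synonym lazy_level = "nat \<times> nat \<times> nat set"

fun lazy_init :: "nat list \<Rightarrow> lazy_level list pmf" where
  "lazy_init [] = return_pmf []"
| "lazy_init (b # bs) = bind_pmf (pmf_of_set {..<width (b # bs)})
     (\<lambda>h. map_pmf ((#) (h, b - 1, {..<width (b # bs)} - {h})) (lazy_init bs))"

text \<open>The coin asks whether a queried child in \<open>U\<close> is among the \<open>s\<close>
  undrawn entries; any other child off the path cannot be one of them.\<close>

fun lazy_step :: "nat list \<Rightarrow> lazy_level list \<Rightarrow> nat \<Rightarrow> lazy_level list option pmf" where
  "lazy_step (b # bs) ((h, s, U) # r) v =
     (let a = v div tree_size bs in
      if a = h then
        bind_pmf (lazy_step bs r (v mod tree_size bs)) (\<lambda>ro. case ro of
            Some r' \<Rightarrow> return_pmf (Some ((h, s, U) # r'))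
          | None \<Rightarrow> if s = 0 then return_pmf None
              else bind_pmf (pmf_of_set U)
                (\<lambda>h'. map_pmf (\<lambda>r'. Some ((h', s - 1, U - {h'}) # r')) (lazy_init bs)))
      else if a \<in> U then
        map_pmf (\<lambda>c. Some ((h, if c then s - 1 else s, U - {a}) # r)) (bernoulli_pmf (real s / real (card U)))
      else return_pmf (Some ((h, s, U) # r)))"
| "lazy_step _ _ v = return_pmf None"

fun lazy_output :: "nat list \<Rightarrow> lazy_level list \<Rightarrow> nat" where
  "lazy_output (b # bs) ((h, s, U) # r) = h * tree_size bs + lazy_output bs r"
| "lazy_output _ _ = 0"

text \<open>The law of the full state given the lazy one; this is the kernel that couples the two
  algorithms.\<close>

fun reveal :: "lazy_level list \<Rightarrow> nat list list pmf" where
  "reveal [] = return_pmf []"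
| "reveal ((h, s, U) # r) = bind_pmf (distinct_list_pmf U s) (\<lambda>xs. map_pmf ((#) (h # xs)) (reveal r))"

fun reveal_option :: "lazy_level list option \<Rightarrow> nat list list option pmf" where
  "reveal_option None = return_pmf None"
| "reveal_option (Some l) = map_pmf Some (reveal l)"

text \<open>\<open>E\<close> is the set of past queries, restricted to the subtree.\<close>

fun lazy_valid :: "nat list \<Rightarrow> lazy_level list \<Rightarrow> nat set \<Rightarrow> bool" where
  "lazy_valid [] l E \<longleftrightarrow> l = [] \<and> E = {}"
| "lazy_valid (b # bs) [] E \<longleftrightarrow> False"
| "lazy_valid (b # bs) ((h, s, U) # r) E \<longleftrightarrow>
     U \<subseteq> {..<width (b # bs)} \<and> h < width (b # bs) \<and> h \<notin> U \<and>
     s < b \<and> s \<le> card U \<and> card U + b \<le> width (b # bs) + s \<and>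
     (\<forall>e\<in>E. e div tree_size bs \<notin> U) \<and>
     lazy_valid bs r ((\<lambda>e. e mod tree_size bs) ` {e\<in>E. e div tree_size bs = h})"

section \<open>Coupling and invariant of the lazy process\<close>

lemma width_bound:
  assumes "0 \<notin> set (b # bs)"
  shows "0 < width (b # bs)" "b \<le> width (b # bs)"
proof -
  have "prod_list bs \<noteq> 0" "b \<noteq> 0" using assms by (auto simp: prod_list_zero_iff)
  then have "b * 1 \<le> b * prod_list bs" "b * prod_list bs > 0" by (auto simp del: mult_1_right)
  then show "0 < width (b # bs)" "b \<le> width (b # bs)"
    using \<open>b \<noteq> 0\<close> by (auto simp: width_def)
qed

lemma lazy_valid_finite: "lazy_valid (b # bs) ((h, s, U) # r) E \<Longrightarrow> finite U"
  by (auto intro: finite_subset)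

text \<open>Draws on different levels are independent, so the tail of a list may be drawn after the
  levels below it.\<close>

lemma tree_init_reveal: "0 \<notin> set bs \<Longrightarrow> tree_init bs = bind_pmf (lazy_init bs) reveal"
proof (induction bs)
  case (Cons b bs)
  then obtain b' where b: "b = Suc b'" by (cases b) auto
  let ?W = "{..<width (b # bs)}"
  have "tree_init (b # bs) = bind_pmf (pmf_of_set ?W) (\<lambda>h. bind_pmf (distinct_list_pmf (?W - {h}) b')
      (\<lambda>xs. bind_pmf (lazy_init bs) (\<lambda>r. map_pmf ((#) (h # xs)) (reveal r))))"
    using Cons by (simp add: b bind_assoc_pmf bind_map_pmf map_bind_pmf)
  also have "\<dots> = bind_pmf (pmf_of_set ?W) (\<lambda>h. bind_pmf (lazy_init bs)
      (\<lambda>r. bind_pmf (distinct_list_pmf (?W - {h}) b') (\<lambda>xs. map_pmf ((#) (h # xs)) (reveal r))))"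
    by (intro bind_pmf_cong refl) (rule bind_commute_pmf)
  also have "\<dots> = bind_pmf (lazy_init (b # bs)) reveal"
    by (simp add: b bind_assoc_pmf bind_map_pmf)
  finally show ?case .
qed (simp add: bind_return_pmf)

text \<open>The commutation of steps that the transfer of runs asks for. If the query leaves the
  path at a child in \<open>U\<close>, it is \<open>map_removeAll_distinct_list_pmf\<close>; if it
  stays on the path, it follows by induction, since the undrawn entries of this level do not
  influence the subtree.\<close>

lemma reveal_tree_step:
  assumes "0 \<notin> set bs" "lazy_valid bs l E"
  shows "bind_pmf (reveal l) (\<lambda>xs. tree_step bs xs v) = bind_pmf (lazy_step bs l v) reveal_option"
  using assms
proof (induction bs arbitrary: l E v)
  case Nil
  then show ?case by (simp add: bind_return_pmf)
next
  case (Cons b bs)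
  from Cons.prems obtain h s U r where l: "l = (h, s, U) # r"
    by (cases l) auto
  note V = Cons.prems(2)[unfolded l]
  have fin: "finite U" using V by (rule lazy_valid_finite)
  let ?D = "distinct_list_pmf U s"
  let ?a = "v div tree_size bs" and ?v = "v mod tree_size bs"
  consider "?a = h" | "?a \<noteq> h" "?a \<in> U" | "?a \<noteq> h" "?a \<notin> U" by blast
  then show ?case
  proof cases
    case 1
    let ?c = "\<lambda>xs ro. case ro of Some r' \<Rightarrow> return_pmf (Some ((h # xs) # r'))
          | None \<Rightarrow> if xs = [] then return_pmf None
              else map_pmf (\<lambda>r'. Some (xs # r')) (tree_init bs)"
    let ?lc = "\<lambda>ro. case ro of
            Some r' \<Rightarrow> return_pmf (Some ((h, s, U) # r'))
          | None \<Rightarrow> if s = 0 then return_pmf None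
              else bind_pmf (pmf_of_set U)
                (\<lambda>h'. map_pmf (\<lambda>r'. Some ((h', s - 1, U - {h'}) # r')) (lazy_init bs))"
    have some: "bind_pmf ?D (\<lambda>xs. bind_pmf (reveal_option (Some r')) (?c xs)) = reveal_option (Some ((h, s, U) # r'))" for r'
      by (simp add: bind_map_pmf map_bind_pmf pmf.map_comp o_def) (simp add: map_pmf_def)
    \<comment> \<open>When the subtree is used up, the next head is the first undrawn entry: it is
      drawn now, and its successors stay deferred.\<close>
    have none: "bind_pmf ?D (\<lambda>xs. ?c xs None) = bind_pmf (?lc None) reveal_option"
    proof (cases s)
      case 0
      then show ?thesis by (simp add: bind_return_pmf)
    next
      case (Suc s')
      have "bind_pmf ?D (\<lambda>xs. ?c xs None) = bind_pmf (pmf_of_set U) (\<lambda>h'.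
          bind_pmf (distinct_list_pmf (U - {h'}) s') (\<lambda>xs. bind_pmf (lazy_init bs)
            (\<lambda>r'. map_pmf (\<lambda>r'. Some ((h' # xs) # r')) (reveal r'))))"
        using Cons.prems(1)
        by (simp add: Suc bind_assoc_pmf bind_map_pmf map_bind_pmf tree_init_reveal)
      also have "\<dots> = bind_pmf (pmf_of_set U) (\<lambda>h'. bind_pmf (lazy_init bs) (\<lambda>r'.
          bind_pmf (distinct_list_pmf (U - {h'}) s') (\<lambda>xs. map_pmf (\<lambda>r'. Some ((h' # xs) # r')) (reveal r'))))"
        by (intro bind_pmf_cong refl) (rule bind_commute_pmf)
      also have "\<dots> = bind_pmf (?lc None) reveal_option"
        by (simp add: Suc bind_assoc_pmf bind_map_pmf map_bind_pmf pmf.map_comp o_def)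
      finally show ?thesis .
    qed
    have "bind_pmf (reveal l) (\<lambda>xs. tree_step (b # bs) xs v)
        = bind_pmf ?D (\<lambda>xs. bind_pmf (bind_pmf (reveal r) (\<lambda>r. tree_step bs r ?v)) (?c xs))"
      using 1 by (simp add: l bind_assoc_pmf bind_map_pmf) (unfold list.sel, rule refl)
    also have "bind_pmf (reveal r) (\<lambda>r. tree_step bs r ?v) = bind_pmf (lazy_step bs r ?v) reveal_option"
      using Cons.prems V by (intro Cons.IH) auto
    also have "bind_pmf ?D (\<lambda>xs. bind_pmf (bind_pmf (lazy_step bs r ?v) reveal_option) (?c xs))
       = bind_pmf (lazy_step bs r ?v) (\<lambda>ro. bind_pmf ?D (\<lambda>xs. bind_pmf (reveal_option ro) (?c xs)))"
      unfolding bind_assoc_pmf by (rule bind_commute_pmf)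
    also have "\<dots> = bind_pmf (lazy_step bs r ?v) (\<lambda>ro. bind_pmf (?lc ro) reveal_option)"
    proof (rule bind_pmf_cong[OF refl])
      fix ro
      show "bind_pmf ?D (\<lambda>xs. bind_pmf (reveal_option ro) (?c xs)) = bind_pmf (?lc ro) reveal_option"
      proof (cases ro)
        case None
        have "bind_pmf ?D (\<lambda>xs. bind_pmf (reveal_option None) (?c xs)) = bind_pmf ?D (\<lambda>xs. ?c xs None)"
          by (simp add: bind_return_pmf)
        then show ?thesis using none None by simp
      next
        case (Some r')
        then show ?thesis using some by (simp add: bind_return_pmf)
      qed
    qed
    also have "\<dots> = bind_pmf (lazy_step (b # bs) l v) reveal_option"
      using 1 by (simp add: l bind_assoc_pmf)
    finally show ?thesis .
  next
    case 2
    have "bind_pmf (reveal l) (\<lambda>xs. tree_step (b # bs) xs v)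
       = bind_pmf (map_pmf (removeAll ?a) ?D) (\<lambda>xs. map_pmf (\<lambda>r. Some ((h # xs) # r)) (reveal r))"
      using 2 by (simp add: l bind_assoc_pmf bind_map_pmf) (simp add: map_pmf_def)
    also have "map_pmf (removeAll ?a) ?D = bind_pmf (bernoulli_pmf (real s / real (card U)))
      (\<lambda>c. distinct_list_pmf (U - {?a}) (if c then s - 1 else s))"
      using 2 V fin by (intro map_removeAll_distinct_list_pmf) auto
    finally show ?thesis
      using 2 by (simp add: l bind_assoc_pmf bind_map_pmf map_bind_pmf pmf.map_comp o_def)
  next
    case 3
    have "bind_pmf (reveal l) (\<lambda>xs. tree_step (b # bs) xs v)
       = bind_pmf ?D (\<lambda>xs. map_pmf (\<lambda>r. Some ((h # removeAll ?a xs) # r)) (reveal r))"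
      using 3 by (simp add: l bind_assoc_pmf bind_map_pmf) (simp add: map_pmf_def)
    also have "\<dots> = bind_pmf ?D (\<lambda>xs. map_pmf (\<lambda>r. Some ((h # xs) # r)) (reveal r))"
    proof (intro bind_pmf_cong refl)
      fix xs assume "xs \<in> set_pmf ?D"
      then have "set xs \<subseteq> U" using V fin set_distinct_list_pmf by fastforce
      then have "removeAll ?a xs = xs" using 3 by (intro removeAll_id) auto
      then show "map_pmf (\<lambda>r. Some ((h # removeAll ?a xs) # r)) (reveal r) = map_pmf (\<lambda>r. Some ((h # xs) # r)) (reveal r)"
        by simp
    qed
    finally show ?thesis
      using 3 by (simp add: l bind_return_pmf map_bind_pmf pmf.map_comp o_def)
  qed
qed

lemma lazy_init_valid:
  assumes "0 \<notin> set bs" "l \<in> set_pmf (lazy_init bs)"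
  shows "lazy_valid bs l {}"
  using assms
proof (induction bs arbitrary: l)
  case (Cons b bs)
  let ?w = "width (b # bs)"
  have w: "0 < ?w" "b \<le> ?w" using width_bound Cons.prems by auto
  then have ne: "{..<?w} \<noteq> {}" by auto
  from Cons.prems(2) ne obtain h r where l: "l = (h, b - 1, {..<?w} - {h}) # r" "h < ?w"
    and r: "r \<in> set_pmf (lazy_init bs)" by auto
  have "lazy_valid bs r {}" using Cons r by auto
  then show ?case using l w Cons.prems by auto
qed simp

text \<open>A child leaves \<open>U\<close> as soon as it is queried or becomes the head, so the
  children left in \<open>U\<close> have untouched subtrees.\<close>

lemma lazy_step_valid:
  assumes "0 \<notin> set bs" "lazy_valid bs l E" "Some l' \<in> set_pmf (lazy_step bs l v)"
  shows "lazy_valid bs l' (insert v E)"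
  using assms
proof (induction bs arbitrary: l E v l')
  case (Cons b bs)
  from Cons.prems obtain h s U r where l: "l = (h, s, U) # r"
    by (cases l) auto
  note V = Cons.prems(2)[unfolded l]
  have fin: "finite U" using V by (rule lazy_valid_finite)
  let ?m = "tree_size bs"
  let ?a = "v div ?m" and ?v = "v mod ?m"
  let ?E = "\<lambda>h E. (\<lambda>e. e mod ?m) ` {e\<in>E. e div ?m = h}"
  have sub: "lazy_valid bs r (?E h E)" using V by simp
  consider "?a = h" | "?a \<noteq> h" "?a \<in> U" | "?a \<noteq> h" "?a \<notin> U" by blast
  then show ?case
  proof cases
    case 1
    have E: "?E h (insert v E) = insert ?v (?E h E)" using 1 by auto
    from Cons.prems(3) 1 consider
      r' where "Some r' \<in> set_pmf (lazy_step bs r ?v)" "l' = (h, s, U) # r'"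
    | h' r' where "s > 0" "h' \<in> set_pmf (pmf_of_set U)" "r' \<in> set_pmf (lazy_init bs)" "l' = (h', s - 1, U - {h'}) # r'"
      by (auto simp: l split: option.splits if_splits)
    then show ?thesis
    proof cases
      case 11: 1
      have "lazy_valid bs r' (insert ?v (?E h E))"
        using Cons.prems(1) 11 sub by (intro Cons.IH[of r]) auto
      then show ?thesis using V 1 11 E by auto
    next
      case 12: 2
      have "U \<noteq> {}" using 12 V by auto
      then have h': "h' \<in> U" using 12 fin by simp
      \<comment> \<open>The new head comes from \<open>U\<close>, so no past query lies in its
        subtree, and the current query lies below the old head.\<close>
      have E: "?E h' (insert v E) = {}" using h' V 1 by auto
      have "lazy_valid bs r' {}" using Cons.prems 12 by (auto intro: lazy_init_valid)
      then show ?thesis unfolding 12(4) lazy_valid.simps E using V 1 12 h' fin by auto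
    qed
  next
    case 2
    have E: "?E h (insert v E) = ?E h E" using 2 by auto
    from Cons.prems(3) 2 obtain c where c: "c \<in> set_pmf (bernoulli_pmf (real s / real (card U)))"
      and l': "l' = (h, if c then s - 1 else s, U - {?a}) # r"
      by (auto simp: l)
    have cU: "card U > 0" "card (U - {?a}) = card U - 1" using fin 2 by (auto simp: card_gt_0_iff)
    have p: "0 \<le> real s / real (card U)" "real s / real (card U) \<le> 1" using V cU by (auto simp: field_simps)
    \<comment> \<open>Outcomes of probability zero are excluded: a hit needs \<open>s > 0\<close>,
      and a miss needs \<open>s < card U\<close>, which keeps \<open>s \<le> card U\<close> true
      once \<open>U\<close> has shrunk.\<close>
    have "if c then s > 0 else s < card U"
    proof (cases c)
      case True
      then show ?thesis using c p cU by (auto simp: set_pmf_iff intro: ccontr)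
    next
      case False
      then have "real s / real (card U) \<noteq> 1" using c p cU by (auto simp: set_pmf_iff)
      then show ?thesis using V False cU by auto
    qed
    then show ?thesis using V 2 E l' cU by (auto split: if_splits)
  next
    case 3
    then have E: "?E h (insert v E) = ?E h E" by auto
    show ?thesis using Cons.prems(3) V 3 E by (auto simp: l)
  qed
qed simp

text \<open>At a leaf, \<open>lazy_valid\<close> demands an empty history; through the mixed radix
  digits this says that the leaf at the end of the path was never queried.\<close>

lemma lazy_output_valid:
  assumes "lazy_valid bs l E" "0 \<notin> set bs"
  shows "lazy_output bs l < tree_size bs \<and> lazy_output bs l \<notin> E"
  using assms
proof (induction bs l E rule: lazy_valid.induct)
  case (3 b bs h s U r E)
  let ?m = "tree_size bs"
  have IH: "lazy_output bs r < ?m" "lazy_output bs r \<notin> (\<lambda>e. e mod ?m) ` {e\<in>E. e div ?m = h}"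
    using 3 by auto
  have "Suc h * ?m \<le> width (b # bs) * ?m" using 3 by (intro mult_right_mono) auto
  then have "h * ?m + lazy_output bs r < width (b # bs) * ?m" using IH by simp
  moreover have "h * ?m + lazy_output bs r \<notin> E"
  proof
    assume "h * ?m + lazy_output bs r \<in> E"
    moreover have "(h * ?m + lazy_output bs r) div ?m = h" "(h * ?m + lazy_output bs r) mod ?m = lazy_output bs r"
      using IH by auto
    ultimately show False using IH by force
  qed
  ultimately show ?case by simp
qed auto

lemma tree_output_reveal:
  assumes "lazy_valid bs l E" "xs \<in> set_pmf (reveal l)"
  shows "tree_output bs xs = lazy_output bs l"
  using assms by (induction bs l E arbitrary: xs rule: lazy_valid.induct) auto

section \<open>The exponential potential\<close>

text \<open>
  The first summand of the exponent charges the lost list entries. The second one counts the queries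
  that missed the list, as these shrink \<open>U\<close> and raise the later hit probability. Once half of the
  children are missed the minimum is attained by the first argument, the value of a subtree that is
  used up, so a bound on the hit probability is needed only before that.
\<close>

fun potential :: "real \<Rightarrow> nat list \<Rightarrow> lazy_level list \<Rightarrow> real" where
  "potential \<kappa> (b # bs) ((h, s, U) # r) =
     min (exp (\<kappa> * prod_list (b # bs)))
       (exp (\<kappa> * prod_list bs * (real b - 1 - real s)
          + \<kappa> / 3 * (real (width (b # bs)) + real s - real b - real (card U))) * potential \<kappa> bs r)"
| "potential \<kappa> _ _ = 1"

fun potential_option :: "real \<Rightarrow> nat list \<Rightarrow> lazy_level list option \<Rightarrow> real" where
  "potential_option \<kappa> bs None = exp (\<kappa> * prod_list bs)"
| "potential_option \<kappa> bs (Some l) = potential \<kappa> bs l"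

lemma potential_le: "\<kappa> \<ge> 0 \<Longrightarrow> potential \<kappa> bs l \<le> exp (\<kappa> * prod_list bs)"
  by (cases "(\<kappa>, bs, l)" rule: potential.cases) auto

lemma potential_option_le: "\<kappa> \<ge> 0 \<Longrightarrow> potential_option \<kappa> bs l \<le> exp (\<kappa> * prod_list bs)"
  by (cases l) (auto intro: potential_le)

text \<open>The exponent is nonnegative: validity contains \<open>s < b\<close> and
  \<open>card U + b \<le> width (b # bs) + s\<close>, and the latter says that the count of misses
  is not negative.\<close>

lemma potential_ge: "\<kappa> \<ge> 0 \<Longrightarrow> lazy_valid bs l E \<Longrightarrow> 1 \<le> potential \<kappa> bs l"
proof (induction bs l E rule: lazy_valid.induct)
  case (3 b bs h s U r E)
  have "real (card U) + real b \<le> real (width (b # bs)) + real s"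
    using 3 by (auto simp: of_nat_add[symmetric] simp del: of_nat_add)
  then have "1 \<le> exp (\<kappa> * prod_list bs * (real b - 1 - real s)
          + \<kappa> / 3 * (real (width (b # bs)) + real s - real b - real (card U)))"
    using 3 by (auto intro!: add_nonneg_nonneg mult_nonneg_nonneg)
  from mult_mono[OF this, of 1 "potential \<kappa> bs r"] show ?case using 3 by auto
qed auto

lemma potential_init:
  assumes "\<kappa> \<ge> 0" "0 \<notin> set bs" "l \<in> set_pmf (lazy_init bs)"
  shows "potential \<kappa> bs l = 1"
  using assms
proof (induction bs arbitrary: l)
  case (Cons b bs)
  let ?w = "width (b # bs)"
  have w: "0 < ?w" "b \<le> ?w" using width_bound Cons.prems by auto
  then have ne: "{..<?w} \<noteq> {}" by auto
  from Cons.prems(3) ne obtain h r where l: "l = (h, b - 1, {..<?w} - {h}) # r" "h < ?w"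
    and r: "r \<in> set_pmf (lazy_init bs)" by auto
  have r1: "potential \<kappa> bs r = 1" using Cons r by auto
  have b: "real (b - 1) = real b - 1" using Cons.prems by (cases b) auto
  have c: "real (card ({..<?w} - {h})) = real ?w - 1" using l w by (simp add: of_nat_diff)
  have "potential \<kappa> (b # bs) l = min (exp (\<kappa> * prod_list (b # bs))) 1"
    unfolding l(1) potential.simps r1 b c by simp
  also have "\<dots> = 1" using Cons.prems by (intro min_absorb2) simp
  finally show ?case .
qed simp

text \<open>On the path, a used up subtree is worth \<open>exp (\<kappa> * prod_list bs)\<close>,
  exactly the charge for the entry lost at this level. Off the path and below the cap, an undrawn
  entry is hit with probability at most \<open>1 / (3 * prod_list bs)\<close>, and a miss is charged
  \<open>\<kappa> / 3\<close>. At the cap nothing can grow.\<close>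

lemma nn_integral_lazy_step:
  assumes "\<kappa> \<ge> 0" "\<kappa> * real (prod_list (tl bs)) \<le> 1" "0 \<notin> set bs" "lazy_valid bs l E"
  shows "(\<integral>\<^sup>+ l'. ennreal (potential_option \<kappa> bs l') \<partial>measure_pmf (lazy_step bs l v))
     \<le> ennreal (exp \<kappa> * potential \<kappa> bs l)"
  using assms
proof (induction bs arbitrary: l E v)
  case Nil
  then show ?case by simp
next
  case (Cons b bs)
  from Cons.prems obtain h s U r where l: "l = (h, s, U) # r"
    by (cases l) auto
  note V = Cons.prems(4)[unfolded l]
  note \<kappa> = Cons.prems(1)
  have fin: "finite U" using V by (rule lazy_valid_finite)
  let ?m = "\<kappa> * prod_list bs"
  let ?w = "width (b # bs)"
  let ?a = "v div tree_size bs" and ?v = "v mod tree_size bs"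
  let ?F = "exp (\<kappa> * prod_list (b # bs))"
  define X where "X = exp (?m * (real b - 1 - real s) + \<kappa> / 3 * (real ?w + real s - real b - real (card U)))"
  have X: "X > 0" by (simp add: X_def)
  have pot: "potential \<kappa> (b # bs) l = min ?F (X * potential \<kappa> bs r)"
    by (simp add: l X_def)
  have "prod_list bs \<noteq> 0" using Cons.prems(3) by (auto simp: prod_list_zero_iff)
  then have P: "prod_list bs \<ge> 1" by simp
  have m: "0 \<le> ?m" "?m \<le> 1" using Cons.prems by auto
  have b: "b \<ge> 1" using V by auto
  have r1: "1 \<le> potential \<kappa> bs r" using V \<kappa> by (auto intro: potential_ge)
  have Fm: "?F = exp (?m * b)" by (simp add: mult_ac)
  have q: "real (card U) + real b \<le> real ?w + real s"
    using V by (auto simp: of_nat_add[symmetric] simp del: of_nat_add)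
  show ?case
  proof (cases "?F \<le> X * potential \<kappa> bs r")
    case True
    have "(\<integral>\<^sup>+ l'. ennreal (potential_option \<kappa> (b # bs) l') \<partial>measure_pmf (lazy_step (b # bs) l v))
      \<le> (\<integral>\<^sup>+ l'. ennreal ?F \<partial>measure_pmf (lazy_step (b # bs) l v))"
      by (intro nn_integral_mono ennreal_leI potential_option_le \<kappa>)
    also have "\<dots> = ennreal (1 * ?F)" by simp
    also have "\<dots> \<le> ennreal (exp \<kappa> * ?F)" using \<kappa> by (intro ennreal_leI mult_right_mono) auto
    finally show ?thesis using True by (simp add: pot)
  next
    case alive: False
    then have pot: "potential \<kappa> (b # bs) l = X * potential \<kappa> bs r" using pot by simp
    consider "?a = h" | "?a \<noteq> h" "?a \<in> U" | "?a \<noteq> h" "?a \<notin> U" by blast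
    then show ?thesis
    proof cases
      case 1
      define c where "c = (\<lambda>ro. case ro of
            Some r' \<Rightarrow> return_pmf (Some ((h, s, U) # r'))
          | None \<Rightarrow> if s = 0 then return_pmf None
              else bind_pmf (pmf_of_set U)
                (\<lambda>h'. map_pmf (\<lambda>r'. Some ((h', s - 1, U - {h'}) # r')) (lazy_init bs)))"
      have c: "potential_option \<kappa> (b # bs) l' \<le> X * potential_option \<kappa> bs ro"
        if "l' \<in> set_pmf (c ro)" for ro l'
      proof (cases ro)
        case (Some r')
        then show ?thesis using that by (simp add: c_def X_def)
      next
        case None
        show ?thesis
        proof (cases "s = 0")
          case True
          \<comment> \<open>No entry is left: the charges for the \<open>b - 1\<close> entries
            behind the first head and for one more reach the cap.\<close>
          have "?m * b \<le> ?m * (real b - 1 - real s) + \<kappa> / 3 * (real ?w + real s - real b - real (card U)) + ?m"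
          proof -
            have "0 \<le> \<kappa> / 3 * (real ?w + real s - real b - real (card U))"
              using q \<kappa> by (intro mult_nonneg_nonneg) auto
            moreover have "?m * b = ?m * (real b - 1 - real s) + ?m" using True by (simp add: algebra_simps)
            ultimately show ?thesis by linarith
          qed
          then have "?F \<le> X * exp ?m"
            unfolding Fm X_def exp_add[symmetric] by simp
          then show ?thesis using that True None by (simp add: c_def)
        next
          case False
          then have ne: "U \<noteq> {}" using V by auto
          with that None False fin obtain h' r' where h': "h' \<in> U" and r': "r' \<in> set_pmf (lazy_init bs)"
            and l': "l' = Some ((h', s - 1, U - {h'}) # r')" by (auto simp: c_def)
          have "potential \<kappa> bs r' = 1" using r' \<kappa> Cons.prems(3) by (intro potential_init) auto
          moreover have s1: "real (s - 1) = real s - 1" using False by (cases s) auto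
          moreover have "card U > 0" using ne fin by (simp add: card_gt_0_iff)
          then have "real (card (U - {h'})) = real (card U) - 1" using fin h' by (simp add: of_nat_diff)
          \<comment> \<open>One more entry is lost, but \<open>s\<close> and \<open>card U\<close>
            fall together, so no miss is counted.\<close>
          ultimately have "potential_option \<kappa> (b # bs) l' \<le> exp (?m * (real b - 1 - (real s - 1))
            + \<kappa> / 3 * (real ?w + (real s - 1) - real b - (real (card U) - 1)))"
            unfolding l' potential_option.simps potential.simps by (intro min.coboundedI2) simp
          also have "\<dots> = X * exp ?m"
            unfolding X_def exp_add[symmetric] by (simp add: algebra_simps)
          finally show ?thesis by (simp add: None)
        qed
      qed
      have "(\<integral>\<^sup>+ l'. ennreal (potential_option \<kappa> (b # bs) l') \<partial>measure_pmf (lazy_step (b # bs) l v))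
        = (\<integral>\<^sup>+ ro. \<integral>\<^sup>+ l'. ennreal (potential_option \<kappa> (b # bs) l') \<partial>measure_pmf (c ro) \<partial>measure_pmf (lazy_step bs r ?v))"
        using 1 by (simp add: l c_def)
      also have "\<dots> \<le> (\<integral>\<^sup>+ ro. \<integral>\<^sup>+ l'. ennreal (X * potential_option \<kappa> bs ro) \<partial>measure_pmf (c ro) \<partial>measure_pmf (lazy_step bs r ?v))"
        using c by (intro nn_integral_mono nn_integral_mono_AE) (auto simp: AE_measure_pmf_iff intro!: ennreal_leI)
      also have "\<dots> = ennreal X * (\<integral>\<^sup>+ ro. ennreal (potential_option \<kappa> bs ro) \<partial>measure_pmf (lazy_step bs r ?v))"
        using X by (simp add: ennreal_mult' nn_integral_cmult)
      also have "\<dots> \<le> ennreal X * ennreal (exp \<kappa> * potential \<kappa> bs r)"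
      proof (rule mult_left_mono)
        have "\<kappa> * prod_list (tl bs) \<le> 1"
        proof (cases bs)
          case (Cons b' bs')
          have "\<kappa> * prod_list bs' \<le> ?m"
            using P \<kappa> Cons Cons.prems(3) by (intro mult_left_mono) (auto simp: Cons)
          then show ?thesis using m Cons by simp
        qed (use Cons.prems in auto)
        then show "(\<integral>\<^sup>+ ro. ennreal (potential_option \<kappa> bs ro) \<partial>measure_pmf (lazy_step bs r ?v)) \<le> ennreal (exp \<kappa> * potential \<kappa> bs r)"
          using Cons.prems V by (intro Cons.IH) auto
      qed simp
      also have "\<dots> = ennreal (exp \<kappa> * potential \<kappa> (b # bs) l)"
        unfolding pot using X by (simp add: ennreal_mult'[symmetric] mult_ac)
      finally show ?thesis .
    next
      case 2
      define p where "p = real s / real (card U)"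
      have cU: "card U > 0" using fin 2 by (auto simp: card_gt_0_iff)
      then have p01: "0 \<le> p" "p \<le> 1" using V by (auto simp: p_def field_simps)
      have cU1: "real (card (U - {?a})) = real (card U) - 1" using cU fin 2 by (simp add: of_nat_diff)
      define t where "t = real ?w + real s - real b - real (card U)"
      have w: "real ?w = 6 * (real b * prod_list bs)" by (simp add: width_def)
      \<comment> \<open>Below the cap the number \<open>t\<close> of misses is less than
        \<open>3 * b * prod_list bs\<close>, half of the width; here the factor 6 in
        \<open>width\<close> and the weight \<open>\<kappa> / 3\<close> of a miss fit
        together.\<close>
      have "X < ?F"
        using alive r1 X mult_left_mono[of 1 "potential \<kappa> bs r" X] by linarith
      then have "?m * (real b - 1 - real s) + \<kappa> / 3 * t < ?m * b"
        unfolding X_def Fm t_def by simp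
      moreover have "0 \<le> ?m * (real b - 1 - real s)" using V by (intro mult_nonneg_nonneg[OF m(1)]) auto
      ultimately have tb: "\<kappa> * t < \<kappa> * (3 * (real b * prod_list bs))" by (simp add: mult_ac)
      then have \<kappa>0: "\<kappa> > 0" using \<kappa> by (cases "\<kappa> = 0") auto
      with tb have t: "t < 3 * (real b * prod_list bs)" by (simp only: mult_less_cancel_left_pos)
      \<comment> \<open>With so few misses, \<open>card U\<close> is still at least
        \<open>3 * s * prod_list bs\<close>.\<close>
      have p_le: "p * (3 * prod_list bs) \<le> 1"
      proof -
        have "s < b" using V by simp
        have "real (card U) > real s - real b + 3 * (real b * prod_list bs)" using t w by (simp add: t_def)
        moreover have "(real b - real s) * 1 \<le> (real b - real s) * (3 * prod_list bs)"
          using P \<open>s < b\<close> by (intro mult_left_mono) auto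
        ultimately have "real s * (3 * prod_list bs) \<le> real (card U)" by (simp add: algebra_simps)
        then show ?thesis using cU by (simp add: p_def field_simps)
      qed
      have "(\<integral>\<^sup>+ l'. ennreal (potential_option \<kappa> (b # bs) l') \<partial>measure_pmf (lazy_step (b # bs) l v)) 
        = (\<integral>\<^sup>+ c. ennreal (potential \<kappa> (b # bs) ((h, if c then s - 1 else s, U - {?a}) # r)) \<partial>measure_pmf (bernoulli_pmf p))"
        using 2 by (simp add: l p_def)
      also have "\<dots> = ennreal p * ennreal (potential \<kappa> (b # bs) ((h, s - 1, U - {?a}) # r))
         + ennreal (1 - p) * ennreal (potential \<kappa> (b # bs) ((h, s, U - {?a}) # r))"
        using p01 by (simp add: mult.commute)
      \<comment> \<open>A hit lowers \<open>s\<close> and \<open>card U\<close> together and costs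
        \<open>exp ?m\<close>; a miss lowers only \<open>card U\<close> and costs
        \<open>exp (\<kappa> / 3)\<close>.\<close>
      also have "\<dots> \<le> ennreal p * ennreal (X * exp ?m * potential \<kappa> bs r)
         + ennreal (1 - p) * ennreal (X * exp (\<kappa> / 3) * potential \<kappa> bs r)"
      proof (intro add_mono)
        show "ennreal (1 - p) * ennreal (potential \<kappa> (b # bs) ((h, s, U - {?a}) # r))
          \<le> ennreal (1 - p) * ennreal (X * exp (\<kappa> / 3) * potential \<kappa> bs r)"
          unfolding potential.simps X_def exp_add[symmetric] cU1
          by (intro mult_left_mono ennreal_leI min.coboundedI2) (simp_all add: algebra_simps)
        show "ennreal p * ennreal (potential \<kappa> (b # bs) ((h, s - 1, U - {?a}) # r))
          \<le> ennreal p * ennreal (X * exp ?m * potential \<kappa> bs r)"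
        \<comment> \<open>For \<open>s = 0\<close> the truncated \<open>s - 1\<close> does no harm,
          since then \<open>p = 0\<close>.\<close>
        proof (cases s)
          case 0
          then show ?thesis by (simp add: p_def)
        next
          case (Suc s')
          then have s1: "real (s - 1) = real s - 1" by simp
          show ?thesis
            unfolding potential.simps X_def exp_add[symmetric] cU1 s1
            by (intro mult_left_mono ennreal_leI min.coboundedI2) (simp_all add: algebra_simps)
        qed
      qed
      also have "\<dots> = ennreal ((p * exp ?m + (1 - p) * exp (\<kappa> / 3)) * (X * potential \<kappa> bs r))"
        using p01 X r1 by (simp add: ennreal_mult'[symmetric] ennreal_plus[symmetric] algebra_simps del: ennreal_plus)
      also have "\<dots> \<le> ennreal (exp \<kappa> * (X * potential \<kappa> bs r))"
      proof (intro ennreal_leI mult_right_mono)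
        \<comment> \<open>As \<open>?m \<le> 1\<close>, \<open>exp ?m \<le> 1 + 2 * ?m\<close>, so
          hits account for at most \<open>2 * \<kappa> / 3\<close> of the exponent and misses for
          the remaining \<open>\<kappa> / 3\<close>.\<close>
        have "exp ?m \<le> 1 + ?m + ?m\<^sup>2" using m by (intro exp_bound) auto
        also have "?m\<^sup>2 \<le> ?m" using m by (simp add: power2_eq_square mult_left_le_one_le)
        finally have "p * exp ?m \<le> p * (1 + 2 * ?m)" using p01 by (intro mult_left_mono) auto
        moreover have "p * (2 * ?m) = (2 * \<kappa> / 3) * (p * (3 * prod_list bs))" by simp
        moreover have "\<dots> \<le> (2 * \<kappa> / 3) * 1" using \<kappa> p_le by (intro mult_left_mono) auto
        ultimately have 1: "p * exp ?m + (1 - p) \<le> 1 + 2 * \<kappa> / 3" by (simp add: algebra_simps)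
        have "p * exp ?m + (1 - p) * exp (\<kappa> / 3) \<le> p * exp ?m * exp (\<kappa> / 3) + (1 - p) * exp (\<kappa> / 3)"
          using p01 \<kappa> mult_left_mono[of 1 "exp (\<kappa> / 3)" "p * exp ?m"] by simp
        also have "\<dots> = (p * exp ?m + (1 - p)) * exp (\<kappa> / 3)" by (simp add: algebra_simps)
        also have "\<dots> \<le> (1 + 2 * \<kappa> / 3) * exp (\<kappa> / 3)" using 1 by (intro mult_right_mono) auto
        also have "\<dots> \<le> exp (2 * \<kappa> / 3) * exp (\<kappa> / 3)"
          using exp_ge_add_one_self[of "2 * \<kappa> / 3"] by (intro mult_right_mono) auto
        also have "\<dots> = exp \<kappa>" by (simp add: exp_add[symmetric])
        finally show "p * exp ?m + (1 - p) * exp (\<kappa> / 3) \<le> exp \<kappa>" .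
      qed (use X r1 in auto)
      finally show ?thesis by (simp add: pot)
    next
      case 3
      have "1 * potential \<kappa> (b # bs) l \<le> exp \<kappa> * potential \<kappa> (b # bs) l"
        using \<kappa> X r1 by (intro mult_right_mono) (auto simp: pot)
      then show ?thesis using 3 by (simp add: l ennreal_leI del: potential.simps)
    qed
  qed
qed

section \<open>Error and space\<close>

text \<open>Inputs and outputs in \<open>{1..n}\<close> are shifted by one to leaves counted from 0.
  \<open>None\<close> is the absorbing failure state.\<close>

definition tree_alg :: "nat list \<Rightarrow> nat list list option rt_alg" where
  "tree_alg bs = \<lparr>states = insert None (Some ` tree_states bs),
     init_dist = map_pmf Some (tree_init bs),
     trans_dist = (\<lambda>so e. case so of None \<Rightarrow> return_pmf None | Some xs \<Rightarrow> tree_step bs xs (e - 1)),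
     state_output = (\<lambda>so. case so of None \<Rightarrow> 0 | Some xs \<Rightarrow> Suc (tree_output bs xs))\<rparr>"

text \<open>A device of the analysis: its transcripts are studied, its states are never
  counted.\<close>

definition lazy_alg :: "nat list \<Rightarrow> lazy_level list option rt_alg" where
  "lazy_alg bs = \<lparr>states = UNIV,
     init_dist = map_pmf Some (lazy_init bs),
     trans_dist = (\<lambda>lo e. case lo of None \<Rightarrow> return_pmf None | Some l \<Rightarrow> lazy_step bs l (e - 1)),
     state_output = (\<lambda>lo. case lo of None \<Rightarrow> 0 | Some l \<Rightarrow> Suc (lazy_output bs l))\<rparr>"

definition lazy_reachable :: "nat list \<Rightarrow> lazy_level list option set" where
  "lazy_reachable bs = {lo. \<forall>l. lo = Some l \<longrightarrow> (\<exists>E. lazy_valid bs l E)}"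

lemma lazy_alg_reachable:
  assumes "0 \<notin> set bs"
  shows "set_pmf (init_dist (lazy_alg bs)) \<subseteq> lazy_reachable bs"
    and "lo \<in> lazy_reachable bs \<Longrightarrow> set_pmf (trans_dist (lazy_alg bs) lo e) \<subseteq> lazy_reachable bs"
  using assms
  by (auto simp: lazy_alg_def lazy_reachable_def split: option.splits
      dest: lazy_init_valid lazy_step_valid)

lemma mif_error_tree_alg:
  assumes "0 \<notin> set bs"
  shows "mif_error n m (tree_alg bs) adv = mif_error n m (lazy_alg bs) adv"
proof (rule mif_error_intertwine[where K=reveal_option and I="lazy_reachable bs"])
  show "init_dist (tree_alg bs) = bind_pmf (init_dist (lazy_alg bs)) reveal_option"
    using assms by (simp add: tree_alg_def lazy_alg_def tree_init_reveal map_bind_pmf bind_map_pmf)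
next
  fix lo e assume lo: "lo \<in> lazy_reachable bs"
  show "bind_pmf (reveal_option lo) (\<lambda>s. trans_dist (tree_alg bs) s e) =
      bind_pmf (trans_dist (lazy_alg bs) lo e) reveal_option"
  proof (cases lo)
    case None
    then show ?thesis by (simp add: tree_alg_def lazy_alg_def bind_return_pmf)
  next
    case (Some l)
    then obtain E where "lazy_valid bs l E" using lo by (auto simp: lazy_reachable_def)
    with reveal_tree_step[OF assms this, of "e - 1"] Some show ?thesis
      by (simp add: tree_alg_def lazy_alg_def bind_map_pmf)
  qed
next
  fix lo so assume "lo \<in> lazy_reachable bs" "so \<in> set_pmf (reveal_option lo)"
  then show "state_output (tree_alg bs) so = state_output (lazy_alg bs) lo"
    by (cases lo) (auto simp: tree_alg_def lazy_alg_def lazy_reachable_def dest: tree_output_reveal)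
qed (use assms lazy_alg_reachable in auto)

lemma mif_correct_snoc:
  assumes "mif_correct n es vs" "v \<in> {1..n}" "v \<notin> set es" "v \<noteq> e"
  shows "mif_correct n (es @ [e]) (vs @ [v])"
  using assms unfolding mif_correct_def by (auto simp: nth_append less_Suc_eq)

text \<open>Failure is absorbing, so a state \<open>Some l\<close> means that no earlier step
  failed, and each output so far was a leaf not queried up to then.\<close>

lemma lazy_alg_correct:
  assumes "0 \<notin> set bs" "tree_size bs \<le> n" "(Some l, es, vs) \<in> set_pmf (rt_run (lazy_alg bs) adv i)"
  shows "lazy_valid bs l ((\<lambda>e. e - 1) ` set es) \<and> mif_correct n es vs"
  using assms(3)
proof (induction i arbitrary: l es vs)
  case 0
  then show ?case using assms(1) by (auto simp: lazy_alg_def mif_correct_def lazy_init_valid)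
next
  case (Suc i)
  then obtain lo es' vs' where run: "(lo, es', vs') \<in> set_pmf (rt_run (lazy_alg bs) adv i)"
    and tr: "Some l \<in> set_pmf (trans_dist (lazy_alg bs) lo (adv vs'))"
    and es: "es = es' @ [adv vs']" "vs = vs' @ [state_output (lazy_alg bs) (Some l)]"
    by auto
  from tr obtain l' where lo: "lo = Some l'" and st: "Some l \<in> set_pmf (lazy_step bs l' (adv vs' - 1))"
    by (auto simp: lazy_alg_def split: option.splits)
  have IH: "lazy_valid bs l' ((\<lambda>e. e - 1) ` set es')" "mif_correct n es' vs'"
    using Suc.IH run lo by auto
  have v: "lazy_valid bs l ((\<lambda>e. e - 1) ` set es)"
    using lazy_step_valid[OF assms(1) IH(1) st] by (simp add: es)
  have o: "lazy_output bs l < tree_size bs" "lazy_output bs l \<notin> (\<lambda>e. e - 1) ` set es"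
    using lazy_output_valid[OF v assms(1)] by auto
  have "Suc (lazy_output bs l) \<notin> set es"
    using o(2) by force
  then have "mif_correct n es vs"
    unfolding es using IH(2) o(1) assms(2) by (intro mif_correct_snoc) (auto simp: es lazy_alg_def)
  with v show ?case by simp
qed

text \<open>Markov's inequality: the expected potential is at most \<open>exp (\<kappa> * m)\<close>
  after \<open>m\<close> inputs, while failure has potential
  \<open>exp (\<kappa> * prod_list bs)\<close>.\<close>

lemma tree_alg_error:
  assumes "0 \<notin> set bs" "tree_size bs \<le> n" "\<kappa> \<ge> 0" "\<kappa> * real (prod_list (tl bs)) \<le> 1"
  shows "mif_error n m (tree_alg bs) adv \<le> exp (\<kappa> * real m - \<kappa> * real (prod_list bs))"
proof -
  let ?R = "rt_run (lazy_alg bs) adv m"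
  let ?F = "exp (\<kappa> * prod_list bs)"
  let ?N = "{x :: lazy_level list option \<times> nat list \<times> nat list. fst x = None}"
  have "mif_error n m (tree_alg bs) adv = measure_pmf.prob ?R {(s, es, vs). \<not> mif_correct n es vs}"
    using assms by (simp add: mif_error_tree_alg) (simp add: mif_error_def)
  also have "\<dots> \<le> measure_pmf.prob ?R ?N"
  proof (rule measure_pmf.finite_measure_mono_AE)
    show "AE x in measure_pmf ?R. x \<in> {(s, es, vs). \<not> mif_correct n es vs} \<longrightarrow> x \<in> ?N"
      unfolding AE_measure_pmf_iff
    proof clarify
      fix lo es vs assume "(lo, es, vs) \<in> set_pmf ?R" "\<not> mif_correct n es vs"
      then show "fst (lo, es, vs) = None"
        using lazy_alg_correct[OF assms(1,2)] by (cases lo) auto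
    qed
  qed simp
  finally have 1: "mif_error n m (tree_alg bs) adv \<le> measure_pmf.prob ?R ?N" .
  have "(\<integral>\<^sup>+ x. ennreal (potential_option \<kappa> bs (fst x)) \<partial>measure_pmf ?R) \<le> ennreal (exp \<kappa>) ^ m"
  proof (rule conjunct1[OF nn_integral_rt_run_le[where I="lazy_reachable bs"]])
    fix lo assume "lo \<in> set_pmf (init_dist (lazy_alg bs))"
    then show "ennreal (potential_option \<kappa> bs lo) \<le> 1"
      using assms by (auto simp: lazy_alg_def potential_init)
  next
    fix lo e assume lo: "lo \<in> lazy_reachable bs"
    show "(\<integral>\<^sup>+ l'. ennreal (potential_option \<kappa> bs l') \<partial>measure_pmf (trans_dist (lazy_alg bs) lo e))
      \<le> ennreal (exp \<kappa>) * ennreal (potential_option \<kappa> bs lo)"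
    proof (cases lo)
      case None
      have "1 * ?F \<le> exp \<kappa> * ?F" using assms by (intro mult_right_mono) auto
      then show ?thesis using None by (simp add: lazy_alg_def ennreal_mult'[symmetric] ennreal_leI)
    next
      case (Some l)
      then obtain E where "lazy_valid bs l E" using lo by (auto simp: lazy_reachable_def)
      from nn_integral_lazy_step[OF assms(3,4,1) this, of "e - 1"] show ?thesis
        using Some by (simp add: lazy_alg_def ennreal_mult'[symmetric])
    qed
  qed (use assms lazy_alg_reachable in auto)
  also have "\<dots> = ennreal (exp (\<kappa> * m))"
    by (simp add: ennreal_power exp_of_nat_mult[symmetric] mult.commute)
  finally have 2: "(\<integral>\<^sup>+ x. ennreal (potential_option \<kappa> bs (fst x)) \<partial>measure_pmf ?R) \<le> ennreal (exp (\<kappa> * m))" .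
  have "ennreal (?F * measure_pmf.prob ?R ?N) = (\<integral>\<^sup>+ x. ennreal ?F * indicator ?N x \<partial>measure_pmf ?R)"
    by (simp add: nn_integral_cmult_indicator ennreal_mult' measure_pmf.emeasure_eq_measure)
  also have "\<dots> \<le> (\<integral>\<^sup>+ x. ennreal (potential_option \<kappa> bs (fst x)) \<partial>measure_pmf ?R)"
    by (intro nn_integral_mono) (auto simp: indicator_def)
  also note 2
  finally have "ennreal (?F * measure_pmf.prob ?R ?N) \<le> ennreal (exp (\<kappa> * m))" .
  then have "?F * measure_pmf.prob ?R ?N \<le> exp (\<kappa> * m)" by simp
  then have "measure_pmf.prob ?R ?N \<le> exp (\<kappa> * m) / ?F" by (simp add: field_simps)
  with 1 show ?thesis unfolding exp_diff by (rule order_trans)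
qed

section \<open>Counting states\<close>

lemma tree_init_states:
  assumes "0 \<notin> set bs" "xs \<in> set_pmf (tree_init bs)"
  shows "xs \<in> tree_states bs"
  using assms
proof (induction bs arbitrary: xs)
  case (Cons b bs)
  then obtain ys r where xs: "xs = ys # r" and r: "r \<in> set_pmf (tree_init bs)"
    and ys: "ys \<in> set_pmf (distinct_list_pmf {..<width (b # bs)} b)" by auto
  have "set ys \<subseteq> {..<width (b # bs)} \<and> length ys = b"
    using width_bound[OF Cons.prems(1)] ys by (intro set_distinct_list_pmf) auto
  moreover have "r \<in> tree_states bs" using Cons r by auto
  ultimately show ?case by (auto simp: xs)
qed simp

lemma tree_step_states:
  assumes "0 \<notin> set bs" "xs \<in> tree_states bs" "Some ys \<in> set_pmf (tree_step bs xs v)"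
  shows "ys \<in> tree_states bs"
  using assms
proof (induction bs arbitrary: xs ys v)
  case (Cons b bs)
  then obtain zs r where xs: "xs = zs # r" and zs: "set zs \<subseteq> {..<width (b # bs)}" "length zs \<le> b"
    and r: "r \<in> tree_states bs" by auto
  have "set (tl zs) \<subseteq> set zs" by (cases zs) auto
  then have tl: "set (tl zs) \<subseteq> {..<width (b # bs)}" "length (tl zs) \<le> b" using zs by auto
  have rm: "set (removeAll a zs) \<subseteq> {..<width (b # bs)}" "length (removeAll a zs) \<le> b" for a
    using zs by (auto intro: order_trans[OF length_removeAll_less_eq])
  consider
      r' where "Some r' \<in> set_pmf (tree_step bs r (v mod tree_size bs))" "ys = zs # r'"
    | r' where "r' \<in> set_pmf (tree_init bs)" "ys = tl zs # r'"
    | "ys = removeAll (v div tree_size bs) zs # r"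
  proof (cases "v div tree_size bs = hd zs")
    case True
    with Cons.prems(3) obtain ro where ro: "ro \<in> set_pmf (tree_step bs r (v mod tree_size bs))"
      and ys: "Some ys \<in> set_pmf (case ro of Some r' \<Rightarrow> return_pmf (Some (zs # r'))
          | None \<Rightarrow> if tl zs = [] then return_pmf None
              else map_pmf (\<lambda>r'. Some (tl zs # r')) (tree_init bs))"
      by (auto simp: xs)
    show ?thesis
    proof (cases ro)
      case None
      then show ?thesis using ys that(2) by (auto split: if_splits)
    next
      case (Some r')
      then show ?thesis using ro ys that(1) by auto
    qed
  next
    case False
    then show ?thesis using Cons.prems(3) that(3) by (simp add: xs)
  qed
  then show ?case
  proof cases
    case 1
    then have "r' \<in> tree_states bs" using Cons r by auto
    then show ?thesis using 1 zs by auto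
  next
    case 2
    then have "r' \<in> tree_states bs" using Cons.prems by (intro tree_init_states) auto
    then show ?thesis using 2 tl by auto
  next
    case 3
    show ?thesis
      unfolding 3 tree_states.simps using rm[of "v div tree_size bs"] r
      by (intro image_eqI[where x="(removeAll (v div tree_size bs) zs, r)"]) auto
  qed
qed simp

text \<open>The sum counts lists of length at most \<open>b\<close> over \<open>w\<close> symbols;
  padding them with one extra symbol explains the right-hand side.\<close>

lemma sum_power_le: "(\<Sum>i\<le>b. w ^ i) \<le> (w + 1 :: nat) ^ b"
proof (induction b)
  case (Suc b)
  have "w ^ Suc b \<le> w * (w + 1) ^ b" by (simp add: power_mono)
  from add_mono[OF Suc this] show ?case by simp
qed simp

lemma card_tree_states:
  assumes "\<And>b' bs'. suffix (b' # bs') bs \<Longrightarrow> width (b' # bs') \<le> w"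
  shows "finite (tree_states bs) \<and> card (tree_states bs) \<le> (w + 1) ^ sum_list bs"
  using assms
proof (induction bs)
  case (Cons b bs)
  let ?L = "{xs. set xs \<subseteq> {..<width (b # bs)} \<and> length xs \<le> b}"
  have IH: "finite (tree_states bs)" "card (tree_states bs) \<le> (w + 1) ^ sum_list bs"
    using Cons.IH Cons.prems by (simp_all add: suffix_ConsI)
  have fin: "finite ?L" by (rule finite_lists_length_le) simp
  have "card ?L = (\<Sum>i\<le>b. width (b # bs) ^ i)" by (subst card_lists_length_le) auto
  also have "\<dots> \<le> (width (b # bs) + 1) ^ b" by (rule sum_power_le)
  also have "\<dots> \<le> (w + 1) ^ b" using Cons.prems[of b bs] by (intro power_mono) auto
  finally have L: "card ?L \<le> (w + 1) ^ b" .
  have "card (tree_states (b # bs)) \<le> card (?L \<times> tree_states bs)"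
    unfolding tree_states.simps using fin IH by (intro card_image_le) auto
  also have "\<dots> \<le> (w + 1) ^ b * (w + 1) ^ sum_list bs"
    unfolding card_cartesian_product using L IH by (intro mult_mono) auto
  finally show ?case using fin IH by (simp add: power_add)
qed simp

lemma width_suffix_le:
  assumes "0 \<notin> set bs" "suffix cs bs"
  shows "width cs \<le> width bs"
proof -
  from assms obtain ds where bs: "bs = ds @ cs" by (auto simp: suffix_def)
  then have "prod_list ds \<noteq> 0" using assms by (auto simp: prod_list_zero_iff)
  then show ?thesis by (simp add: bs width_def)
qed

lemma rt_algorithm_tree_alg:
  assumes "0 \<notin> set bs"
  shows "rt_algorithm n (tree_alg bs)"
proof -
  have "finite (tree_states bs)"
    using card_tree_states[of bs "width bs"] width_suffix_le[OF assms] by auto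
  moreover have "set_pmf (trans_dist (tree_alg bs) so e) \<subseteq> states (tree_alg bs)"
    if so: "so \<in> states (tree_alg bs)" for so e
  proof
    fix so' assume so': "so' \<in> set_pmf (trans_dist (tree_alg bs) so e)"
    show "so' \<in> states (tree_alg bs)"
    proof (cases so')
      case None
      then show ?thesis by (simp add: tree_alg_def)
    next
      case (Some ys)
      then obtain xs where "xs \<in> tree_states bs" "Some ys \<in> set_pmf (tree_step bs xs (e - 1))"
        using so so' by (auto simp: tree_alg_def)
      then show ?thesis using assms Some by (auto simp: tree_alg_def intro: tree_step_states)
    qed
  qed
  moreover have "set_pmf (init_dist (tree_alg bs)) \<subseteq> states (tree_alg bs)"
    using tree_init_states[OF assms] by (auto simp: tree_alg_def)
  ultimately show ?thesis unfolding rt_algorithm_def by (simp add: tree_alg_def)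
qed

lemma space_bits_tree_alg:
  assumes "0 \<notin> set bs" "width bs \<le> w"
  shows "space_bits (tree_alg bs) \<le> 1 + real (sum_list bs) * log 2 (real w + 1)"
proof -
  have c: "finite (tree_states bs)" "card (tree_states bs) \<le> (w + 1) ^ sum_list bs"
    using card_tree_states[of bs w] order_trans[OF width_suffix_le[OF assms(1)] assms(2)] by auto
  have "card (states (tree_alg bs)) \<le> Suc (card (tree_states bs))"
    using c by (simp add: tree_alg_def card_insert_if card_image)
  also have "\<dots> \<le> 2 * (w + 1) ^ sum_list bs"
    using c(2) one_le_power[of "w + 1" "sum_list bs"] by linarith
  finally have "real (card (states (tree_alg bs))) \<le> real (2 * (w + 1) ^ sum_list bs)"
    using of_nat_le_iff by blast
  moreover have "0 < card (states (tree_alg bs))"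
    using c by (auto simp: tree_alg_def card_gt_0_iff)
  ultimately have "space_bits (tree_alg bs) \<le> log 2 (real (2 * (w + 1) ^ sum_list bs))"
    unfolding space_bits_def by (subst log_le_cancel_iff) auto
  also have "\<dots> = 1 + real (sum_list bs) * log 2 (real w + 1)"
    by (simp add: log_mult log_nat_power add.commute)
  finally show ?thesis .
qed

section \<open>The deterministic algorithm for short streams\<close>

definition trivial_alg :: "nat \<Rightarrow> nat rt_alg" where
  "trivial_alg m = \<lparr>states = set_encode ` Pow {1..Suc m}, init_dist = return_pmf (set_encode {}),
     trans_dist = (\<lambda>s e. return_pmf (set_encode (set_decode s \<union> ({e} \<inter> {1..Suc m})))),
     state_output = (\<lambda>s. SOME v. v \<in> {1..Suc m} - set_decode s)\<rparr>"

text \<open>Pigeonhole: after at most \<open>m\<close> inputs one of the \<open>m + 1\<close>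
  candidates is free, so the choice in the output is well defined.\<close>

lemma trivial_alg_correct:
  assumes "(s, es, vs) \<in> set_pmf (rt_run (trivial_alg m) adv i)" "i \<le> m" "m < n"
  shows "set_decode s = set es \<inter> {1..Suc m} \<and> length es = i \<and> mif_correct n es vs"
  using assms(1,2)
proof (induction i arbitrary: s es vs)
  case 0
  then show ?case by (auto simp: trivial_alg_def mif_correct_def)
next
  case (Suc i)
  have tr: "trans_dist (trivial_alg m) s e = return_pmf (set_encode (set_decode s \<union> ({e} \<inter> {1..Suc m})))" for s e
    by (simp add: trivial_alg_def)
  from Suc.prems(1) obtain s' es' vs' where run: "(s', es', vs') \<in> set_pmf (rt_run (trivial_alg m) adv i)"
    and s: "s = set_encode (set_decode s' \<union> ({adv vs'} \<inter> {1..Suc m}))"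
    and es: "es = es' @ [adv vs']" "vs = vs' @ [state_output (trivial_alg m) s]"
    unfolding rt_run.simps tr by (force simp del: Int_insert_left Int_insert_left_if0 Int_insert_left_if1)
  have IH: "set_decode s' = set es' \<inter> {1..Suc m}" "length es' = i" "mif_correct n es' vs'"
    using Suc.IH[OF run] Suc.prems by auto
  have "set_decode s = set_decode s' \<union> ({adv vs'} \<inter> {1..Suc m})"
    unfolding s by (rule set_encode_inverse) simp
  then have d: "set_decode s = set es \<inter> {1..Suc m}" unfolding IH es by auto
  have "card (set es) \<le> Suc i" using card_length[of es] IH by (simp add: es)
  then have "card (set es) < card {1..Suc m}" using Suc.prems by simp
  then have "{1..Suc m} - set es \<noteq> {}"
    by (metis Diff_eq_empty_iff List.finite_set card_mono not_le)
  then have "\<exists>v. v \<in> {1..Suc m} - set_decode s" unfolding d by blast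
  from someI_ex[OF this] have "state_output (trivial_alg m) s \<in> {1..Suc m} - set_decode s"
    by (simp add: trivial_alg_def)
  then have v: "state_output (trivial_alg m) s \<in> {1..Suc m}" "state_output (trivial_alg m) s \<notin> set es"
    unfolding d by blast+
  have "mif_correct n es vs"
    unfolding es(1,2)
  proof (rule mif_correct_snoc[OF IH(3)])
    show "state_output (trivial_alg m) s \<in> {1..n}" using v(1) assms(3) by auto
  qed (use v(2) es(1) in auto)
  then show ?case using d IH by (simp add: es(1))
qed

lemma rt_algorithm_trivial_alg: "rt_algorithm n (trivial_alg m)"
proof -
  have "set_pmf (trans_dist (trivial_alg m) s e) \<subseteq> states (trivial_alg m)"
    if s: "s \<in> states (trivial_alg m)" for s e
  proof -
    obtain S where S: "S \<subseteq> {1..Suc m}" "s = set_encode S" using s by (auto simp: trivial_alg_def)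
    then have "finite S" by (auto intro: finite_subset)
    then have "set_decode s = S" using S by simp
    then have "set_decode s \<union> ({e} \<inter> {1..Suc m}) \<in> Pow {1..Suc m}" using S by blast
    then show ?thesis unfolding trivial_alg_def by simp
  qed
  moreover have "set_encode {} \<in> states (trivial_alg m)"
    unfolding trivial_alg_def rt_alg.simps by (intro imageI) simp
  then have "set_pmf (init_dist (trivial_alg m)) \<subseteq> states (trivial_alg m)"
    by (simp add: trivial_alg_def)
  moreover have "finite (states (trivial_alg m))" by (simp add: trivial_alg_def)
  ultimately show ?thesis unfolding rt_algorithm_def by blast
qed

lemma mif_robust_trivial_alg:
  assumes "m < n" "0 < \<delta>"
  shows "mif_robust n m \<delta> (trivial_alg m)"
proof -
  have "mif_error n m (trivial_alg m) adv = 0" for adv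
    unfolding mif_error_def measure_pmf_zero_iff
    using trivial_alg_correct[of _ _ _ m adv m n] assms by auto
  then show ?thesis using assms by (simp add: mif_robust_def)
qed

lemma space_bits_trivial_alg: "space_bits (trivial_alg m) \<le> real m + 1"
proof -
  have "card (states (trivial_alg m)) \<le> 2 ^ Suc m"
    using card_image_le[of "Pow {1..Suc m}" set_encode] by (simp add: trivial_alg_def card_Pow)
  then have "real (card (states (trivial_alg m))) \<le> 2 ^ Suc m"
    by (metis of_nat_le_iff of_nat_numeral of_nat_power)
  moreover have "0 < card (states (trivial_alg m))"
    using rt_algorithm_trivial_alg[of 0 m] by (auto simp: card_gt_0_iff rt_algorithm_def trivial_alg_def)
  ultimately have "space_bits (trivial_alg m) \<le> log 2 (2 ^ Suc m)"
    unfolding space_bits_def by (subst log_le_cancel_iff) auto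
  also have "\<dots> = real m + 1" by (subst log_nat_power) auto
  finally show ?thesis .
qed

section \<open>The bounds\<close>

text \<open>The argument of the ceiling in \<open>mif_bound\<close>. It is the \<open>x\<close> with
  \<open>(\<Prod>i<d. 4 * l / x ^ i) = n / 4\<close>: a tree of depth \<open>d\<close> whose widths
  start at \<open>4 * l\<close> and fall by the factor \<open>x\<close> has \<open>n / 4\<close>
  leaves.\<close>

definition mif_x :: "nat \<Rightarrow> nat \<Rightarrow> real" where
  "mif_x n l = (4 * real l) powr (2 / (real_of_int (mif_d n l) - 1)) /
     (real n / 4) powr (2 / (real_of_int (mif_d n l) * (real_of_int (mif_d n l) - 1)))"

lemma mif_x_pos: "1 \<le> l \<Longrightarrow> l < n \<Longrightarrow> mif_x n l > 0"
  unfolding mif_x_def by (intro divide_pos_pos) auto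

lemma mif_d_ge: "mif_d n l \<ge> 2"
  by (simp add: mif_d_def)

lemma ln_mif_x:
  assumes "1 \<le> l" "l < n"
  shows "ln (mif_x n l) = 2 / (real_of_int (mif_d n l) - 1) *
    (ln (4 * real l) - ln (real n / 4) / real_of_int (mif_d n l))"
proof -
  have d: "real_of_int (mif_d n l) \<ge> 2" using mif_d_ge[of n l] by linarith
  then have "ln (mif_x n l) = 2 / (real_of_int (mif_d n l) - 1) * ln (4 * real l)
     - 2 / (real_of_int (mif_d n l) * (real_of_int (mif_d n l) - 1)) * ln (real n / 4)"
    unfolding mif_x_def using assms by (subst ln_div) (auto simp: ln_powr)
  then show ?thesis using d by (simp add: right_diff_distrib mult.commute)
qed

lemma mif_bound_eq:
  "mif_bound n l \<delta> = real_of_int \<lceil>mif_x n l\<rceil> * (log 2 (real l))\<^sup>2 + min (real l) (log 2 (1 / \<delta>)) * log 2 (real l)"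
  by (simp add: mif_bound_def mif_x_def Let_def)

text \<open>
  With \<open>X = ln (n / 4)\<close> and \<open>Y = ln (4 l)\<close> the left-hand side is the logarithm of \<open>mif_x n l\<close>, so the
  bound of the second claim holds for every \<open>d \<ge> 2\<close>.
\<close>

lemma quad_bound:
  fixes d X Y :: real
  assumes "d \<ge> 2" "X > 0"
  shows "2 / (d - 1) * (Y - X / d) \<le> Y\<^sup>2 / X"
proof -
  \<comment> \<open>Multiplied by \<open>d * (d - 1) * X\<close>, the claim says that this form is
    nonnegative: a square plus a term with the sign of \<open>d - 2\<close>.\<close>
  have "0 \<le> 2 * (X - d * Y / 2)\<^sup>2 + d * (d - 2) / 2 * Y\<^sup>2"
    using assms by (intro add_nonneg_nonneg mult_nonneg_nonneg) auto
  also have "\<dots> = d * (d - 1) * Y\<^sup>2 - 2 * X * (d * Y - X)"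
    by (simp add: power2_eq_square field_simps)
  finally show ?thesis using assms by (simp add: field_simps power2_eq_square)
qed

text \<open>With \<open>y = ln l\<close> and \<open>z = ln n\<close> the power of \<open>l\<close>
  has the logarithm \<open>y\<^sup>2 / z\<close>; passing to \<open>4 * l\<close> and
  \<open>n / 4\<close> adds at most \<open>7 * ln 4\<close>. For \<open>n < 16\<close> constants
  suffice.\<close>

lemma mif_x_le:
  assumes "2 \<le> l" "l < n"
  shows "mif_x n l \<le> 4 ^ 7 * real l powr (log (real n) (real l))"
proof -
  define d where "d = real_of_int (mif_d n l)"
  have d: "d \<ge> 2" using mif_d_ge[of n l] unfolding d_def by linarith
  have p1: "1 \<le> real l powr (log (real n) (real l))"
    using assms by (intro ge_one_powr_ge_zero) auto
  show ?thesis
  proof (cases "n \<ge> 16")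
    case True
    define y z a where "y = ln (real l)" and "z = ln (real n)" and "a = ln (4::real)"
    have a: "a > 0" by (simp add: a_def)
    have y: "0 \<le> y" "y \<le> z" using assms by (auto simp: y_def z_def)
    have "ln (16::real) = 2 * a" using ln_realpow[of "4::real" 2] by (simp add: a_def)
    moreover have "ln (16::real) \<le> z" using True by (simp add: z_def)
    ultimately have z: "2 * a \<le> z" by simp
    have "ln (mif_x n l) = 2 / (d - 1) * ((y + a) - (z - a) / d)"
      using assms by (subst ln_mif_x) (auto simp: d_def y_def z_def a_def ln_mult ln_div)
    also have "\<dots> \<le> (y + a)\<^sup>2 / (z - a)" using d a z by (intro quad_bound) auto
    also have "\<dots> \<le> y\<^sup>2 / z + 7 * a"
    proof -
      \<comment> \<open>The 7 is twice \<open>2 + 1/2 + 1\<close>, by \<open>y \<le> z\<close> and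
        \<open>a \<le> z / 2\<close>; the doubling comes from
        \<open>z / 2 \<le> z - a\<close>.\<close>
      have "(y + a)\<^sup>2 * z = y\<^sup>2 * (z - a) + (2 * a * (y * z) + a * (a * z) + a * y\<^sup>2)"
        by (simp add: power2_eq_square algebra_simps)
      also have "2 * a * (y * z) + a * (a * z) + a * y\<^sup>2 \<le> 2 * a * (z * z) + a * (z / 2 * z) + a * z\<^sup>2"
        using y a z by (intro add_mono mult_left_mono mult_right_mono power_mono) auto
      also have "\<dots> = 7 * a * z * (z / 2)" by (simp add: power2_eq_square)
      also have "\<dots> \<le> 7 * a * z * (z - a)" using a z by (intro mult_left_mono) auto
      finally have "(y + a)\<^sup>2 * z \<le> y\<^sup>2 * (z - a) + 7 * a * z * (z - a)" by simp
      then show ?thesis using a z by (simp add: field_simps)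
    qed
    finally have "mif_x n l \<le> exp (y\<^sup>2 / z + 7 * a)"
      using mif_x_pos[of l n] assms by (metis exp_le_cancel_iff exp_ln le_less_trans less_imp_le one_le_numeral order_trans)
    also have "\<dots> = exp (y\<^sup>2 / z) * exp a ^ 7" by (simp add: exp_add exp_of_nat_mult[symmetric])
    also have "exp a = 4" by (simp add: a_def)
    also have "exp (y\<^sup>2 / z) = real l powr (log (real n) (real l))"
      using assms by (simp add: powr_def log_def y_def z_def power2_eq_square)
    finally show ?thesis by simp
  next
    case False
    have "(4 * real l) powr (2 / (d - 1)) \<le> (4 * real l) powr 2"
      using d assms by (intro powr_mono) (auto simp: field_simps)
    also have "\<dots> \<le> 64 powr 2" using False assms by (intro powr_mono2) auto
    finally have 1: "(4 * real l) powr (2 / (d - 1)) \<le> 4096" by simp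
    have "1 * 2 \<le> (d - 1) * d" using d by (intro mult_mono) auto
    then have e: "0 \<le> 2 / (d * (d - 1))" "2 / (d * (d - 1)) \<le> 1" using d by (auto simp: field_simps)
    have "1 / 2 = (1 / 2 :: real) powr 1" by simp
    also have "\<dots> \<le> (1 / 2) powr (2 / (d * (d - 1)))" using e by (intro powr_mono') auto
    also have "\<dots> \<le> (real n / 4) powr (2 / (d * (d - 1)))" using assms e by (intro powr_mono2) auto
    finally have 2: "1 / 2 \<le> (real n / 4) powr (2 / (d * (d - 1)))" .
    have "mif_x n l \<le> 4096 / (1 / 2)"
      unfolding mif_x_def d_def[symmetric] using 1 2 by (intro frac_le) auto
    also have "\<dots> \<le> 4 ^ 7 * 1" by simp
    also have "\<dots> \<le> 4 ^ 7 * real l powr (log (real n) (real l))" using p1 by (intro mult_left_mono) auto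
    finally show ?thesis .
  qed
qed

text \<open>The ceiling adds at most 1, which the power of \<open>l\<close> absorbs as it is at
  least 1, and \<open>log 2 (1 / \<delta>)\<close> is at most \<open>k * log 2 n\<close>.\<close>

lemma mif_bound_le_mif_bound_poly:
  assumes l: "1 \<le> l" "l < n" and \<delta>: "1 / real n ^ k \<le> \<delta>" "\<delta> < 1"
  shows "mif_bound n l \<delta> \<le> (4 ^ 7 + 1 + real k) * mif_bound_poly n l"
proof (cases "l = 1")
  case True
  then show ?thesis by (simp add: mif_bound_eq mif_bound_poly_def)
next
  case False
  then have l2: "2 \<le> l" using l by simp
  define p where "p = real l powr (log (real n) (real l))"
  have p1: "1 \<le> p" unfolding p_def using l by (intro ge_one_powr_ge_zero) auto
  have L: "0 \<le> log 2 (real l)" and N: "0 \<le> log 2 (real n)" using l by auto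
  have np: "0 < 1 / real n ^ k" using l by simp
  then have dp: "\<delta> > 0" using \<delta> by linarith
  have "1 / \<delta> \<le> real n ^ k" using \<delta> np dp by (simp add: field_simps)
  then have "log 2 (1 / \<delta>) \<le> log 2 (real n ^ k)" using dp l by (subst log_le_cancel_iff) auto
  also have "\<dots> = k * log 2 (real n)" using l by (simp add: log_nat_power)
  finally have k: "log 2 (1 / \<delta>) \<le> k * log 2 (real n)" .
  have "real_of_int \<lceil>mif_x n l\<rceil> \<le> 4 ^ 7 * p + 1"
    using mif_x_le[OF l2 l(2)] unfolding p_def by linarith
  also have "\<dots> \<le> (4 ^ 7 + 1) * p" using p1 by simp
  finally have c: "real_of_int \<lceil>mif_x n l\<rceil> \<le> (4 ^ 7 + 1) * p" .
  have "mif_bound n l \<delta> \<le> (4 ^ 7 + 1) * p * (log 2 (real l))\<^sup>2 + (k * log 2 (real n)) * log 2 (real l)"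
    unfolding mif_bound_eq using c k L by (intro add_mono mult_right_mono) auto
  also have "\<dots> \<le> (4 ^ 7 + 1 + real k) * (p * (log 2 (real l))\<^sup>2) + (4 ^ 7 + 1 + real k) * (log 2 (real l) * log 2 (real n))"
  proof (rule add_mono)
    show "(4 ^ 7 + 1) * p * (log 2 (real l))\<^sup>2 \<le> (4 ^ 7 + 1 + real k) * (p * (log 2 (real l))\<^sup>2)"
      using p1 unfolding mult.assoc by (intro mult_right_mono) auto
    have "real k * (log 2 (real l) * log 2 (real n)) \<le> (4 ^ 7 + 1 + real k) * (log 2 (real l) * log 2 (real n))"
      using L N by (intro mult_right_mono) auto
    then show "k * log 2 (real n) * log 2 (real l) \<le> (4 ^ 7 + 1 + real k) * (log 2 (real l) * log 2 (real n))"
      by (simp add: mult_ac)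
  qed
  finally show ?thesis by (simp add: mif_bound_poly_def p_def algebra_simps)
qed

section \<open>Fitting the tree below \<open>n\<close>\<close>

lemma tree_size_replicate:
  "tree_size (replicate k b @ [c]) = (\<Prod>j\<le>k. 6 * c * b ^ j)"
  by (induction k) (auto simp: width_def prod_list_replicate mult_ac)

text \<open>\<open>W\<close> bounds the width of the root, and each further level is narrower by a factor \<open>36 x\<close>.\<close>

lemma tree_size_le:
  fixes b1 b c k :: nat and W x :: real
  assumes "0 < x" "36 * x \<le> b" "b \<le> b1" "6 * (b1 * b ^ k * c) \<le> W"
  shows "tree_size (b1 # replicate k b @ [c]) \<le> (\<Prod>i<k+2. (W / 6) / x ^ i)"
proof -
  have b: "real b > 0" using assms by linarith
  have W: "0 \<le> W" using assms(4) by (rule order_trans[rotated]) simp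
  \<comment> \<open>Going down, each level loses the factor \<open>b\<close>, except for the first
    one, which loses \<open>b1 \<ge> b\<close>.\<close>
  have t: "6 * real c * real b ^ j \<le> W / b ^ (Suc (k - j))" if "j \<le> k" for j
  proof -
    have "6 * real c * real b ^ j * b ^ Suc (k - j) = 6 * real c * (real b * real b ^ k)"
      using that by (simp add: power_add[symmetric])
    also have "\<dots> \<le> 6 * real c * (real b1 * real b ^ k)" using assms by (intro mult_left_mono mult_right_mono) auto
    also have "\<dots> \<le> W" using assms(4) by (simp add: mult_ac)
    finally show ?thesis using b by (simp add: field_simps)
  qed
  have "real (tree_size (b1 # replicate k b @ [c])) = 6 * (b1 * b ^ k * c) * (\<Prod>j\<le>k. 6 * real c * real b ^ j)"
    by (simp add: tree_size_replicate width_def prod_list_replicate)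
  also have "\<dots> \<le> W * (\<Prod>j\<le>k. W / b ^ (Suc (k - j)))"
    using t assms(4) W by (intro mult_mono prod_mono prod_nonneg) auto
  also have "(\<Prod>j\<le>k. W / b ^ (Suc (k - j))) = (\<Prod>j\<le>k. W / real b ^ Suc j)"
    using prod.nat_diff_reindex[of "\<lambda>j. W / real b ^ Suc j" "Suc k"]
    by (simp add: lessThan_Suc_atMost del: power_Suc prod.lessThan_Suc)
  also have "W * \<dots> = (\<Prod>i<k+2. W / real b ^ i)"
    by (subst add_2_eq_Suc', subst prod.lessThan_Suc_shift) (simp only: lessThan_Suc_atMost power_0 div_by_1)
  \<comment> \<open>The 36 in \<open>36 * x\<close> is spent on replacing \<open>W\<close> by
    \<open>W / 6\<close>: the factors 6 and 1/6 of the first two levels cancel, and the later ones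
    are below 1.\<close>
  also have "\<dots> \<le> (\<Prod>i<k+2. (6 / 36 ^ i) * ((W / 6) / x ^ i))"
  proof (intro prod_mono conjI)
    fix i
    have "(36 * x) ^ i \<le> real b ^ i" using assms by (intro power_mono) auto
    then have "W / real b ^ i \<le> W / (36 * x) ^ i" using assms W by (intro divide_left_mono mult_pos_pos) auto
    then show "W / real b ^ i \<le> (6 / 36 ^ i) * ((W / 6) / x ^ i)" by (simp add: power_mult_distrib)
  qed (use W in auto)
  also have "\<dots> = (\<Prod>i<k+2. 6 / 36 ^ i) * (\<Prod>i<k+2. (W / 6) / x ^ i)"
    by (rule prod.distrib)
  also have "\<dots> \<le> 1 * (\<Prod>i<k+2. (W / 6) / x ^ i)"
  proof (rule mult_right_mono)
    show "(\<Prod>i<k+2. 6 / 36 ^ i) \<le> (1 :: real)"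
    proof (induction k)
      case (Suc k)
      have "6 / 36 ^ (k + 2) \<le> (6 / 36 :: real)"
        using one_le_power[of "36 :: real" "k + 1"] by (simp add: field_simps)
      then have "6 / 36 ^ (k + 2) \<le> (1 :: real)" by linarith
      from mult_mono[OF Suc this] show ?case by (simp add: mult_ac)
    qed (simp add: numeral_2_eq_2)
    show "0 \<le> (\<Prod>i<k+2. (W / 6) / x ^ i)" using assms W by (intro prod_nonneg) auto
  qed
  finally show ?thesis by simp
qed

text \<open>Under these hypotheses the outer maximum in \<open>mif_d\<close> is idle, so
  \<open>d\<close> is the smaller of two candidates. Both bound \<open>d\<close> from above, one for
  the depth and one for the sizes; the one attained shows that \<open>d\<close> levels reach the
  product \<open>2 * l\<close>.\<close>

lemma mif_d_large:
  assumes l: "2 \<le> l" "l < n" and x: "36 * mif_x n l < 2 * real l" "36 < 2 * real l"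
  defines "d \<equiv> nat (mif_d n l)"
  shows "d \<ge> 2" "real d \<le> 2 * log 2 (real l)"
    "2 * real l \<le> (36 * max 1 (mif_x n l)) ^ d"
    "\<And>D. D \<le> d \<Longrightarrow> (\<Prod>i<D. (4 * real l) / mif_x n l ^ i) \<le> real n / 4"
proof -
  define X where "X = ln (real n / 4)"
  define Y where "Y = ln (real l)"
  define a where "a = ln (4::real)"
  have a: "a > 0" by (simp add: a_def)
  have Y: "Y > 0" using l by (simp add: Y_def)
  have ln4l: "ln (4 * real l) = Y + a" using l by (simp add: Y_def a_def ln_mult)
  have "ln (16::real) = 2 * a" using ln_realpow[of "4::real" 2] by (simp add: a_def)
  then have ln16l: "ln (16 * real l) = Y + 2 * a" using l by (simp add: Y_def ln_mult)
  define f where "f = \<lfloor>2 * (log 2 (real n / 4) / log 2 (16 * real l))\<rfloor>"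
  have f: "f = \<lfloor>2 * (X / (Y + 2 * a))\<rfloor>"
    by (simp add: f_def log_def X_def ln16l[symmetric])
  have md: "mif_d n l = max 2 (min \<lceil>log 2 (real l)\<rceil> f)" by (simp add: mif_d_def f_def)
  have x0: "mif_x n l > 0" using l by (intro mif_x_pos) auto
  \<comment> \<open>\<open>f < 2\<close> would force \<open>d = 2\<close> and
    \<open>n / 4 < 16 * l\<close>, hence \<open>mif_x n l > l\<close>, against the
    hypothesis.\<close>
  have f2: "f \<ge> 2"
  proof (rule ccontr)
    assume "\<not> f \<ge> 2"
    then have "mif_d n l = 2" by (simp add: md)
    moreover have "2 * (X / (Y + 2 * a)) < 2" using \<open>\<not> f \<ge> 2\<close> unfolding f by linarith
    then have "X < Y + 2 * a" using Y a by (simp add: field_simps)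
    ultimately have "ln (mif_x n l) > Y"
      using l by (subst ln_mif_x) (auto simp: ln4l X_def)
    then have "real l < mif_x n l" using x0 l by (simp add: Y_def)
    then show False using x l by linarith
  qed
  have L: "log 2 (real l) > 4" 
  proof -
    have "log 2 (2 ^ 4) < log 2 (real l)" using x by (subst log_less_cancel_iff) auto
    moreover have "log 2 (2 ^ 4) = (4 :: real)" by (subst log_nat_power) auto
    ultimately show ?thesis by simp
  qed
  then have mdm: "mif_d n l = min \<lceil>log 2 (real l)\<rceil> f" using f2 by (simp add: md)
  have d: "real d = real_of_int (mif_d n l)" using mif_d_ge[of n l] by (simp add: d_def)
  show d2: "d \<ge> 2" using mif_d_ge[of n l] by (simp add: d_def)
  then have rd2: "real d \<ge> 2" by simp
  have "real d \<le> log 2 (real l) + 1" unfolding d mdm by linarith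
  then show "real d \<le> 2 * log 2 (real l)" using L by linarith
  have "real d \<le> f" unfolding d mdm by linarith
  also have "\<dots> \<le> 2 * (X / (Y + 2 * a))" unfolding f by linarith
  finally have dX: "real d * (Y + 2 * a) \<le> 2 * X" using Y a by (simp add: field_simps)
  define u where "u = ln (mif_x n l)"
  have xu: "mif_x n l = exp u" using x0 by (simp add: u_def)
  have "u = 2 / (real d - 1) * (Y + a - X / d)"
    using l by (simp add: u_def ln_mif_x d ln4l X_def)
  then have u: "u * (real d - 1) * d = 2 * (d * (Y + a) - X)" using rd2 by (simp add: field_simps)
  then have "u * (real d - 1) * d \<le> d * Y" using dX by (simp add: algebra_simps)
  then have uY: "u * (real d - 1) \<le> Y" using rd2 by (simp add: mult.commute)
  \<comment> \<open>So \<open>mif_x n l ^ i \<le> l\<close> for \<open>i < d\<close>: all factors of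
    the product are at least 1, and a prefix of it is bounded by the whole.\<close>
  have iu: "real i * u \<le> Y" if "i < d" for i
  proof (cases "u \<ge> 0")
    case True
    have "real i * u \<le> (real d - 1) * u" using that True by (intro mult_right_mono) auto
    then show ?thesis using uY by (simp add: mult.commute)
  next
    case False
    then have "real i * u \<le> 0" by (simp add: mult_nonneg_nonpos)
    then show ?thesis using Y by linarith
  qed
  have gauss: "(\<Sum>i<m. real i) = real m * (real m - 1) / 2" for m
    by (induction m) (auto simp: field_simps)
  have prod_d: "(\<Prod>i<d. (4 * real l) / mif_x n l ^ i) = real n / 4"
  proof -
    have "(\<Prod>i<d. (4 * real l) / mif_x n l ^ i) = (\<Prod>i<d. exp (Y + a - real i * u))"
      using l ln4l by (intro prod.cong) (auto simp: xu exp_diff exp_of_nat_mult[symmetric] ln4l[symmetric])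
    also have "\<dots> = exp (\<Sum>i<d. Y + a - real i * u)" by (simp add: exp_sum)
    also have "(\<Sum>i<d. Y + a - real i * u) = real d * (Y + a) - real d * (real d - 1) / 2 * u"
      by (simp add: sum_subtractf sum_distrib_right[symmetric] gauss)
    also have "\<dots> = X" using u by (simp add: field_simps)
    also have "exp X = real n / 4" using l by (simp add: X_def)
    finally show ?thesis .
  qed
  show "(\<Prod>i<D. (4 * real l) / mif_x n l ^ i) \<le> real n / 4" if "D \<le> d" for D
  proof -
    have "(\<Prod>i<D. (4 * real l) / mif_x n l ^ i) \<le> (\<Prod>i<d. (4 * real l) / mif_x n l ^ i)"
    proof (rule prod_mono2)
      fix i assume "i \<in> {..<d} - {..<D}"
      then have "exp (real i * u) \<le> exp Y" using iu by auto
      then have "mif_x n l ^ i \<le> 4 * real l" using l by (simp add: xu Y_def exp_of_nat_mult)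
      then show "1 \<le> 4 * real l / mif_x n l ^ i" using x0 by simp
    qed (use that l x0 in auto)
    then show ?thesis using prod_d by simp
  qed
  show "2 * real l \<le> (36 * max 1 (mif_x n l)) ^ d"
  \<comment> \<open>If \<open>d\<close> is the rounded logarithm, powers of 4 are enough. If it is
    the floor, \<open>d + 1\<close> exceeds the quotient, which turns into
    \<open>mif_x n l ^ d \<ge> l / 16\<close>; the 16 is covered by \<open>36 ^ d\<close>.\<close>
  proof (cases "\<lceil>log 2 (real l)\<rceil> \<le> f")
    case True
    then have "log 2 (real l) \<le> real d" unfolding d mdm by linarith
    then have "real l \<le> 2 powr real d" using l by (simp add: log_le_iff)
    then have "2 * real l \<le> 2 ^ Suc d" by (simp add: powr_realpow)
    also have "\<dots> \<le> 2 ^ (2 * d)" using d2 by (intro power_increasing) auto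
    also have "\<dots> = 4 ^ d" by (simp add: power_mult)
    also have "\<dots> \<le> (36 * max 1 (mif_x n l)) ^ d" by (intro power_mono) auto
    finally show ?thesis .
  next
    case False
    then have "real d = f" unfolding d mdm by simp
    then have "2 * (X / (Y + 2 * a)) < real d + 1" unfolding f by linarith
    then have "2 * X < (real d + 1) * (Y + 2 * a)" using Y a by (simp add: field_simps)
    moreover have "(real d - 1) * (d * u) = 2 * (d * (Y + a) - X)" using u by (simp add: mult_ac)
    moreover have "(real d + 1) * (Y + 2 * a) = 2 * (d * (Y + a)) - (real d - 1) * Y + 2 * a"
      by (simp add: algebra_simps)
    moreover have "1 * (2 * a) \<le> (real d - 1) * (2 * a)" using rd2 a by (intro mult_right_mono) auto
    ultimately have "(real d - 1) * (Y - 2 * a) \<le> (real d - 1) * (d * u)"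
      by (simp add: right_diff_distrib)
    then have "Y - 2 * a \<le> d * u" using rd2 by simp
    then have "exp (Y - 2 * a) \<le> exp (d * u)" by simp
    moreover have "exp (2 * a) = 16" unfolding a_def using exp_of_nat_mult[of 2 "ln 4 :: real"] by simp
    ultimately have xd: "real l / 16 \<le> mif_x n l ^ d"
      using l by (simp add: exp_diff Y_def xu exp_of_nat_mult)
    have "(36 :: real) ^ 2 \<le> 36 ^ d" using d2 by (intro power_increasing) auto
    then have "36 ^ 2 * (real l / 16) \<le> 36 ^ d * mif_x n l ^ d" using xd by (intro mult_mono) auto
    then have "2 * real l \<le> 36 ^ d * mif_x n l ^ d" by simp
    also have "\<dots> = (36 * mif_x n l) ^ d" by (simp add: power_mult_distrib)
    also have "\<dots> \<le> (36 * max 1 (mif_x n l)) ^ d" using x0 by (intro power_mono) auto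
    finally show ?thesis .
  qed
qed

text \<open>Powers of \<open>b\<close> alone could overshoot \<open>2 * l\<close> by almost a factor
  \<open>b\<close>, too much for the widths. So \<open>k\<close> is maximal below
  \<open>2 * l\<close>, and a last factor \<open>c\<close> lands within a factor of 2.\<close>

lemma obtain_branching:
  fixes b b1 l :: nat
  assumes "2 \<le> b" "b \<le> b1" "b1 < 2 * l"
  obtains k c where "0 < c" "c \<le> b + 1" "b1 * b ^ k < 2 * l" "2 * l \<le> b1 * b ^ k * c" "b1 * b ^ k * c \<le> 4 * l"
proof -
  define k where "k = (LEAST k. 2 * l \<le> b1 * b ^ Suc k)"
  have "2 * l < 2 ^ Suc l" using less_exp[of l] by simp
  also have "\<dots> \<le> b ^ Suc l" using assms by (intro power_mono) auto
  also have "\<dots> \<le> b1 * b ^ Suc l" using assms by simp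
  finally have "2 * l \<le> b1 * b ^ Suc l" by (rule less_imp_le)
  then have k: "2 * l \<le> b1 * b ^ Suc k" unfolding k_def by (rule LeastI)
  have kl: "b1 * b ^ k < 2 * l"
  proof (cases k)
    case 0
    then show ?thesis using assms by simp
  next
    case (Suc k')
    then show ?thesis using not_less_Least[of k' "\<lambda>k. 2 * l \<le> b1 * b ^ Suc k"] by (simp add: k_def)
  qed
  define B where "B = b1 * b ^ k"
  have B: "B > 0" using assms by (simp add: B_def)
  \<comment> \<open>Rounding up costs at most one \<open>B\<close>, and
    \<open>B < 2 * l\<close>.\<close>
  define c where "c = 2 * l div B + 1"
  have "2 * l div B \<le> b"
    using k B div_le_mono[of "2 * l" "B * b" B] by (simp add: B_def mult_ac)
  moreover have Bc: "B * c = B + B * (2 * l div B)" by (simp add: c_def)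
  moreover have "2 * l \<le> B * c" "B * c \<le> 4 * l"
    using kl[folded B_def] times_div_less_eq_dividend[of B "2 * l"]
      dividend_less_times_div[OF B, of "2 * l"] unfolding Bc by linarith+
  ultimately show ?thesis using that[of c k] kl by (simp add: c_def B_def)
qed

text \<open>\<kappa> is the largest value that \<open>tree_alg_error\<close> admits; the exponent is
  then at most \<open>b1 / 2 - b1\<close>.\<close>

lemma tree_alg_robust:
  assumes bs: "bs = b1 # cs" and "0 \<notin> set bs" "tree_size bs \<le> n" "2 * l \<le> prod_list bs"
    and \<delta>: "0 < \<delta>" "2 * ln (1 / \<delta>) \<le> b1"
  shows "mif_robust n l \<delta> (tree_alg bs)"
  unfolding mif_robust_def
proof (intro allI impI)
  fix adv
  define \<kappa> where "\<kappa> = 1 / real (prod_list cs)"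
  have "prod_list cs \<noteq> 0" using assms by (auto simp: prod_list_zero_iff)
  then have P: "real (prod_list cs) > 0" by simp
  have "real (2 * l) \<le> real (b1 * prod_list cs)" using assms(4) unfolding bs of_nat_le_iff by simp
  then have "\<kappa> * real l \<le> real b1 / 2" using P by (simp add: \<kappa>_def field_simps)
  moreover have "\<kappa> * real (prod_list bs) = b1" using P by (simp add: \<kappa>_def bs)
  ultimately have "\<kappa> * real l - \<kappa> * real (prod_list bs) \<le> - ln (1 / \<delta>)" using \<delta> by linarith
  also have "\<dots> = ln \<delta>" using \<delta> by (simp add: ln_div)
  finally have "exp (\<kappa> * real l - \<kappa> * real (prod_list bs)) \<le> \<delta>"
    using \<delta> by (metis exp_le_cancel_iff exp_ln)
  moreover have "mif_error n l (tree_alg bs) adv \<le> exp (\<kappa> * real l - \<kappa> * real (prod_list bs))"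
    using assms P by (intro tree_alg_error) (auto simp: \<kappa>_def)
  ultimately show "mif_error n l (tree_alg bs) adv \<le> \<delta>" by linarith
qed

section \<open>Choice of parameters\<close>

lemma ex_mif_alg:
  assumes l: "1 \<le> l" "l < n" and \<delta>: "0 < \<delta>" "\<delta> < 1"
  shows "\<exists>A :: nat rt_alg. rt_algorithm n A \<and> mif_robust n l \<delta> A \<and>
    space_bits A \<le> 700 * max 1 (mif_bound n l \<delta>)"
proof -
  define \<alpha> where "\<alpha> = nat \<lceil>mif_x n l\<rceil>"
  define y where "y = log 2 (1 / \<delta>)"
  define \<mu> where "\<mu> = log 2 (real l)"
  \<comment> \<open>The 36 is the slack required by \<open>tree_size_le\<close>; the surplus of
    \<open>b1\<close> over \<open>b\<close> serves \<delta> alone.\<close>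
  define b where "b = 36 * \<alpha>"
  define b1 where "b1 = b + nat \<lceil>2 * y\<rceil>"
  have x0: "mif_x n l > 0" using l by (rule mif_x_pos)
  then have \<alpha>: "real \<alpha> = real_of_int \<lceil>mif_x n l\<rceil>" "\<alpha> \<ge> 1" "mif_x n l \<le> real \<alpha>"
    by (auto simp: \<alpha>_def of_nat_ceiling) linarith
  have y: "y > 0" "ln (1 / \<delta>) \<le> y"
  proof -
    show "y > 0" using \<delta> by (simp add: y_def)
    have "ln (2 :: real) \<le> 1" using ln_le_minus_one[of "2::real"] by simp
    then have "y * ln 2 \<le> y * 1" using \<open>y > 0\<close> by (intro mult_left_mono) auto
    then show "ln (1 / \<delta>) \<le> y" by (simp add: y_def log_def)
  qed
  have b1: "2 * y \<le> real b1" "real b1 \<le> 36 * real \<alpha> + 2 * y + 1"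
    using y unfolding b1_def b_def by (auto simp: of_nat_nat) linarith+
  have \<mu>0: "\<mu> \<ge> 0" using l by (simp add: \<mu>_def)
  have bound: "mif_bound n l \<delta> = \<alpha> * \<mu>\<^sup>2 + min (real l) y * \<mu>"
    by (simp add: mif_bound_eq \<alpha>(1) \<mu>_def y_def)
  show ?thesis
  \<comment> \<open>In each of these cases \<open>l + 1\<close> bits are within the bound, so the
    deterministic algorithm serves.\<close>
  proof (cases "l = 1 \<or> real l \<le> y \<or> 2 * l \<le> b1")
    case True
    have "real l + 1 \<le> 700 * max 1 (mif_bound n l \<delta>)"
    proof (cases "l = 1")
      case True
      then show ?thesis by simp
    next
      case False
      then have l2: "2 \<le> l" using l by simp
      then have \<mu>: "\<mu> \<ge> 1" by (simp add: \<mu>_def)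
      then have \<alpha>\<mu>: "real \<alpha> * 1 \<le> \<alpha> * \<mu>\<^sup>2" by (intro mult_left_mono) (auto simp: one_le_power)
      show ?thesis
      proof (cases "real l \<le> y")
        case True
        have "real l * 1 \<le> real l * \<mu>" using \<mu> by (intro mult_left_mono) auto
        moreover have "mif_bound n l \<delta> = \<alpha> * \<mu>\<^sup>2 + real l * \<mu>" using True by (simp add: bound min_def)
        moreover have "1 \<le> real \<alpha>" using \<alpha>(2) by simp
        ultimately have "real l + 1 \<le> 700 * mif_bound n l \<delta>" using \<alpha>\<mu> by linarith
        then show ?thesis by linarith
      next
        case False
        then have "2 * real l \<le> 36 * real \<alpha> + 2 * y + 1"
          using \<open>l = 1 \<or> real l \<le> y \<or> 2 * l \<le> b1\<close> \<open>l \<noteq> 1\<close> b1 by auto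
        moreover have "y * 1 \<le> y * \<mu>" using \<mu> y by (intro mult_left_mono) auto
        moreover have "mif_bound n l \<delta> = \<alpha> * \<mu>\<^sup>2 + y * \<mu>" using False by (simp add: bound min_def)
        moreover have "1 \<le> real \<alpha>" "2 \<le> real l" using \<alpha>(2) l2 by auto
        ultimately have "real l + 1 \<le> 700 * mif_bound n l \<delta>" using \<alpha>\<mu> y by linarith
        then show ?thesis by linarith
      qed
    qed
    then show ?thesis
      using l \<delta> rt_algorithm_trivial_alg mif_robust_trivial_alg order_trans[OF space_bits_trivial_alg]
      by (intro exI[of _ "trivial_alg l"]) simp
  next
    case False
    then have l2: "2 \<le> l" and yl: "y < l" and b1l: "b1 < 2 * l" using l by auto
    then have \<mu>: "\<mu> \<ge> 1" by (simp add: \<mu>_def)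
    have bb: "b \<le> b1" "36 \<le> b" using \<alpha> by (auto simp: b_def b1_def)
    obtain k c where c: "0 < c" "c \<le> b + 1" and k: "b1 * b ^ k < 2 * l"
      and P: "2 * l \<le> b1 * b ^ k * c" "b1 * b ^ k * c \<le> 4 * l"
      by (rule obtain_branching[of b b1 l]) (use bb b1l in auto)
    define bs where "bs = b1 # replicate k b @ [c]"
    have bs0: "0 \<notin> set bs" using bb c by (auto simp: bs_def)
    have prod: "prod_list bs = b1 * b ^ k * c" by (simp add: bs_def prod_list_replicate)
    define d where "d = nat (mif_d n l)"
    have "real b < 2 * real l" "36 < 2 * real l" using bb b1l by linarith+
    then have x: "36 * mif_x n l < 2 * real l" "36 < 2 * real l"
    proof -
      have "real b = 36 * real \<alpha>" by (simp add: b_def)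
      then show "36 * mif_x n l < 2 * real l" using \<alpha>(3) \<open>real b < 2 * real l\<close> by linarith
    qed
    note D = mif_d_large[OF l2 l(2) x, folded d_def]
    \<comment> \<open>The tree has \<open>k + 2\<close> levels; with more than \<open>d\<close> of
      them, \<open>b ^ d\<close> would stay below \<open>2 * l\<close>, which depth \<open>d\<close>
      already reaches.\<close>
    have "k + 1 < d"
    proof (rule ccontr)
      assume "\<not> k + 1 < d"
      then have "b ^ d \<le> b ^ (k + 1)" using bb by (intro power_increasing) auto
      also have "\<dots> \<le> b1 * b ^ k" using bb by simp
      also note k
      finally have "real (b ^ d) < real (2 * l)" unfolding of_nat_less_iff .
      then have less: "real b ^ d < 2 * real l" by simp
      have "(36 * max 1 (mif_x n l)) ^ d \<le> real b ^ d"
        using \<alpha> x0 by (intro power_mono) (auto simp: b_def)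
      from order_trans[OF D(3) this] have "2 * real l \<le> real b ^ d" .
      with less show False by simp
    qed
    then have kd: "k + 2 \<le> d" by simp
    \<comment> \<open>The root has width at most \<open>6 * 4 * l\<close>, and division by 6 leaves
      the \<open>4 * l\<close> for which \<open>mif_x\<close> is made.\<close>
    have "tree_size bs \<le> (\<Prod>i<k+2. (24 * real l / 6) / mif_x n l ^ i)"
      unfolding bs_def
    proof (rule tree_size_le[OF x0 _ bb(1)])
      show "36 * mif_x n l \<le> real b" using \<alpha>(3) by (simp add: b_def)
      have "6 * (b1 * b ^ k * c) \<le> 24 * l" using P by linarith
      then have "real (6 * (b1 * b ^ k * c)) \<le> real (24 * l)" unfolding of_nat_le_iff .
      then show "6 * (b1 * b ^ k * c) \<le> 24 * real l" by simp
    qed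
    also have "24 * real l / 6 = 4 * real l" by simp
    also note D(4)[OF kd]
    finally have size: "tree_size bs \<le> n" by linarith
    have sum: "sum_list bs = b1 + k * b + c" by (simp add: bs_def sum_list_replicate)
    have w: "width bs \<le> 24 * l" using P unfolding width_def prod by linarith
    \<comment> \<open>Only the root list depends on \<delta>. The other levels hold at most
      \<open>d * b\<close> entries, a constant multiple of \<open>\<alpha> * \<mu>\<close>, and each
      entry takes at most \<open>6 * \<mu>\<close> bits.\<close>
    have "k * b + c \<le> (k + 2) * b" using c bb unfolding add_mult_distrib by linarith
    then have "real (k * b + c) \<le> real ((k + 2) * b)" unfolding of_nat_le_iff .
    also have "\<dots> \<le> real d * b" using kd unfolding of_nat_mult by (intro mult_right_mono) auto
    also have "\<dots> \<le> (2 * \<mu>) * b" using D(2) by (intro mult_right_mono) (auto simp: \<mu>_def)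
    also have "\<dots> = 72 * (\<alpha> * \<mu>)" by (simp add: b_def)
    finally have "real (sum_list bs) \<le> (36 * real \<alpha> + 2 * y + 1) + 72 * (\<alpha> * \<mu>)"
      using b1 unfolding sum by simp
    also have "\<dots> \<le> 37 * (\<alpha> * \<mu>) + 2 * y + 72 * (\<alpha> * \<mu>)"
    proof -
      have "real \<alpha> * 1 \<le> \<alpha> * \<mu>" using \<mu> by (intro mult_left_mono) auto
      moreover have "1 \<le> real \<alpha>" using \<alpha>(2) by simp
      ultimately show ?thesis by linarith
    qed
    finally have s: "real (sum_list bs) \<le> 109 * (\<alpha> * \<mu>) + 2 * y" by linarith
    have lg: "log 2 (real (24 * l) + 1) \<le> 6 * \<mu>"
    proof -
      have "log 2 (real (24 * l) + 1) \<le> log 2 (2 ^ 5 * real l)"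
        using l2 by (subst log_le_cancel_iff) auto
      also have "\<dots> = log 2 (2 ^ 5) + \<mu>" using l2 by (simp add: log_mult \<mu>_def del: power_numeral)
      also have "log 2 (2 ^ 5) = (5 :: real)" by (subst log_nat_power) auto
      finally show ?thesis using \<mu> by linarith
    qed
    have "space_bits (tree_alg bs) \<le> 1 + real (sum_list bs) * log 2 (real (24 * l) + 1)"
      by (rule space_bits_tree_alg[OF bs0 w])
    also have "\<dots> \<le> 1 + (109 * (\<alpha> * \<mu>) + 2 * y) * (6 * \<mu>)"
      using s lg y \<mu> by (intro add_left_mono mult_mono) auto
    also have "\<dots> \<le> 700 * (\<alpha> * \<mu>\<^sup>2 + y * \<mu>)"
    proof -
      have "1 * 1 \<le> real \<alpha> * \<mu>\<^sup>2" using \<alpha>(2) \<mu> by (intro mult_mono) (auto simp: one_le_power)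
      moreover have "0 \<le> y * \<mu>" using y \<mu> by simp
      moreover have "1 + (654 * p + 12 * q) \<le> 700 * (p + q)" if "1 * 1 \<le> p" "0 \<le> q" for p q :: real
        using that by simp
      moreover have eq: "(109 * (\<alpha> * \<mu>) + 2 * y) * (6 * \<mu>) = 654 * (\<alpha> * \<mu>\<^sup>2) + 12 * (y * \<mu>)"
        by (simp add: power2_eq_square algebra_simps)
      ultimately show ?thesis unfolding eq by blast
    qed
    also have "\<dots> = 700 * mif_bound n l \<delta>" using yl by (simp add: bound min_def)
    finally have "space_bits (tree_alg bs) \<le> 700 * max 1 (mif_bound n l \<delta>)" by linarith
    moreover have "mif_robust n l \<delta> (tree_alg bs)"
      using bs0 size P y b1 \<delta> by (intro tree_alg_robust[OF bs_def]) (auto simp: prod)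
    ultimately show ?thesis
      using rt_algorithm_nat_alg[OF rt_algorithm_tree_alg[OF bs0]] mif_robust_nat_alg
      by (intro exI[of _ "nat_alg (tree_alg bs)"]) (simp add: space_bits_nat_alg)
  qed
qed

text \<open>An error of 1 / poly(n) is read as \<delta> \<ge> 1 / n ^ k, with a constant depending
  on \<open>k\<close>.\<close>

theorem theorem5p6:
  "\<exists>A :: nat \<Rightarrow> nat \<Rightarrow> real \<Rightarrow> nat rt_alg.
     (\<forall>n l \<delta>. 1 \<le> l \<and> l < n \<and> 0 < \<delta> \<and> \<delta> < 1 \<longrightarrow>
        rt_algorithm n (A n l \<delta>) \<and> mif_robust n l \<delta> (A n l \<delta>)) \<and>
     (\<exists>C>0. \<forall>n l \<delta>. 1 \<le> l \<and> l < n \<and> 0 < \<delta> \<and> \<delta> < 1 \<longrightarrow>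
        space_bits (A n l \<delta>) \<le> C * max 1 (mif_bound n l \<delta>)) \<and>
     (\<forall>k::nat. \<exists>C>0. \<forall>n l \<delta>. 1 \<le> l \<and> l < n \<and> 1 / real n ^ k \<le> \<delta> \<and> \<delta> < 1 \<longrightarrow>
        space_bits (A n l \<delta>) \<le> C * max 1 (mif_bound_poly n l))"
proof -
  \<comment> \<open>One choice of algorithm per triple; the second bound is derived from the first
    for the same family.\<close>
  define A :: "nat \<Rightarrow> nat \<Rightarrow> real \<Rightarrow> nat rt_alg" where
    "A n l \<delta> = (SOME A. rt_algorithm n A \<and> mif_robust n l \<delta> A \<and>
      space_bits A \<le> 700 * max 1 (mif_bound n l \<delta>))" for n l \<delta>
  have A: "rt_algorithm n (A n l \<delta>) \<and> mif_robust n l \<delta> (A n l \<delta>) \<and>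
      space_bits (A n l \<delta>) \<le> 700 * max 1 (mif_bound n l \<delta>)"
    if "1 \<le> l" "l < n" "0 < \<delta>" "\<delta> < 1" for n l \<delta>
    unfolding A_def using ex_mif_alg[OF that] by (rule someI_ex)
  have "space_bits (A n l \<delta>) \<le> 700 * (4 ^ 7 + 1 + real k) * max 1 (mif_bound_poly n l)"
    if *: "1 \<le> l" "l < n" "1 / real n ^ k \<le> \<delta>" "\<delta> < 1" for n l \<delta> k
  proof -
    let ?K = "4 ^ 7 + 1 + real k"
    have "0 < 1 / real n ^ k" using * by simp
    then have "0 < \<delta>" using * by linarith
    then have "space_bits (A n l \<delta>) \<le> 700 * max 1 (mif_bound n l \<delta>)" using A * by blast
    moreover have "max 1 (mif_bound n l \<delta>) \<le> ?K * max 1 (mif_bound_poly n l)"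
    proof (rule max.boundedI)
      show "1 \<le> ?K * max 1 (mif_bound_poly n l)"
        using mult_mono[of 1 ?K 1 "max 1 (mif_bound_poly n l)"] by simp
      have "mif_bound n l \<delta> \<le> ?K * mif_bound_poly n l" by (rule mif_bound_le_mif_bound_poly[OF *])
      also have "\<dots> \<le> ?K * max 1 (mif_bound_poly n l)" by (intro mult_left_mono) auto
      finally show "mif_bound n l \<delta> \<le> ?K * max 1 (mif_bound_poly n l)" .
    qed
    ultimately show ?thesis by linarith
  qed
  then have "\<forall>k::nat. \<exists>C>0. \<forall>n l \<delta>. 1 \<le> l \<and> l < n \<and> 1 / real n ^ k \<le> \<delta> \<and> \<delta> < 1 \<longrightarrow>
        space_bits (A n l \<delta>) \<le> C * max 1 (mif_bound_poly n l)"
    by (intro allI exI[of _ "700 * (4 ^ 7 + 1 + real _)"]) auto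
  moreover have "\<exists>C>0. \<forall>n l \<delta>. 1 \<le> l \<and> l < n \<and> 0 < \<delta> \<and> \<delta> < 1 \<longrightarrow>
        space_bits (A n l \<delta>) \<le> C * max 1 (mif_bound n l \<delta>)"
    using A by (intro exI[of _ 700]) auto
  ultimately show ?thesis using A by (intro exI[of _ A]) blast
qed

end
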